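(* There exists a positive constant $C$ such that if $p\geq C\big(\frac{\log n}{n}\big)^{1/2}$, then the random graph $G(n,p)$ is asymptotically almost surely $\mathcal F_n(2)$-universal, i.e., with probability tending to $1$ as $n\to\infty$, $G(n,p)$ contains every graph on $n$ vertices with maximum degree at most $2$ as a subgraph.
   Context: $G(n,p)$ is the binomial random graph on $n$ vertices in which each pair of vertices is an edge independently with probability $p$. $\mathcal F_n(2)$ denotes the family of all graphs on $n$ vertices with maximum degree at most $2$; a graph is $\mathcal F_n(2)$-universal if it contains every member of $\mathcal F_n(2)$ as a subgraph. *)

theory Defs
  imports "HOL-Probability.Probability" "HOL-Library.Ramsey"
begin

text \<open>
  A simple graph on \<open>n\<close> vertices has vertex set \<open>{..<n}\<close> and is represented by its set of
  edges, a subset of \<open>nsets {..<n} 2\<close>, the set of all unordered pairs of distinct vertices.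
\<close>

definition graphs_on :: "nat \<Rightarrow> nat set set set" where
  "graphs_on n = Pow (nsets {..<n} 2)"

definition degree :: "nat set set \<Rightarrow> nat \<Rightarrow> nat" where
  "degree E v = card {e \<in> E. v \<in> e}"

definition bounded_degree_graphs :: "nat \<Rightarrow> nat \<Rightarrow> nat set set set" where
  "bounded_degree_graphs n d = {F \<in> graphs_on n. \<forall>v<n. degree F v \<le> d}"

text \<open>
  Containment is up to isomorphism, that is, \<open>G\<close> has a not necessarily induced subgraph
  isomorphic to \<open>F\<close>.
\<close>

definition contains_copy :: "nat \<Rightarrow> nat set set \<Rightarrow> nat set set \<Rightarrow> bool" where
  "contains_copy n G F \<longleftrightarrow>
     (\<exists>\<phi>. inj_on \<phi> {..<n} \<and> \<phi> ` {..<n} \<subseteq> {..<n} \<and> (\<forall>e\<in>F. \<phi> ` e \<in> G))"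

definition universal :: "nat \<Rightarrow> nat set set set \<Rightarrow> nat set set \<Rightarrow> bool" where
  "universal n \<F> G \<longleftrightarrow> (\<forall>F\<in>\<F>. contains_copy n G F)"

text \<open>
  The indicators of the pairs are independent Bernoulli variables. For \<open>p\<close> outside the unit
  interval \<open>bernoulli_pmf p\<close> is clamped, so \<open>gnp n p\<close> is meaningful only for
  \<open>0 \<le> p \<le> 1\<close>.
\<close>

definition gnp :: "nat \<Rightarrow> real \<Rightarrow> nat set set pmf" where
  "gnp n p = map_pmf (\<lambda>f. {e \<in> nsets {..<n} 2. f e})
     (Pi_pmf (nsets {..<n} 2) False (\<lambda>_. bernoulli_pmf p))"

end

theory Submission
  imports Defs "HOL-Real_Asymp.Real_Asymp"
begin

text \<open>
  Write \<open>G(n,p)\<close> as the union of two independent copies of \<open>G(n,q)\<close> with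
  \<open>(1 - q)\<^sup>2 = 1 - p\<close>, and let \<open>m = n div 60\<close>. The first copy has a path \<open>H\<close> on
  \<open>n - m\<close> vertices, by depth-first search. A graph of maximum degree two lies in a disjoint union
  of cycles and at most one path with at most two vertices. A cycle of length \<open>k\<close> is obtained from
  an interval of \<open>k - 1\<close> vertices of \<open>H\<close> and a further vertex \<open>x\<close> adjacent to both ends of the interval,
  or more generally from several intervals joined up cyclically by such vertices \<open>x\<close>. So it remains
  to match disjoint pairs \<open>(a, b)\<close> of vertices of \<open>H\<close> to the vertices that have not been used,
  where \<open>(a, b)\<close> and \<open>x\<close> may be matched if \<open>a x\<close> and \<open>x b\<close> are edges of the second copy. Each such
  cherry is present with probability \<open>q\<^sup>2\<close>, which is at least a large multiple of \<open>ln n / n\<close>.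

  The pairs depend on the graph to be embedded, and there are too many graphs for a union bound.
  But Hall's condition holds simultaneously for all families of pairs containing a fixed
  family \<open>M\<close> of \<open>m\<close> pairs and all vertex sets containing the fixed set \<open>Y\<close> of vertices outside \<open>H\<close>:
  a small set of arbitrary pairs violating it misses almost all of \<open>Y\<close>, and a small set of
  arbitrary vertices violating it misses almost all of \<open>M\<close>. A bounded number of families \<open>M\<close>
  suffices: either some length between 3 and 8 occurs for at least \<open>m\<close> cycles, which can be placed
  first, or the cycles of length at least 9 have room for \<open>m\<close> blocks \<open>w a x b w'\<close>, where
  \<open>w a b w'\<close> is one of the first \<open>m\<close> blocks of four vertices of \<open>H\<close>.
\<close>

section \<open>Hall's theorem\<close>

text \<open>Halmos-Vaughan induction on the number of indices. If a proper nonempty subfamily is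
  tight, it and the rest are matched separately; otherwise every proper nonempty subfamily has an
  element to spare, so one index may be matched arbitrarily.\<close>

lemma hall_marriage:
  assumes "finite I" "\<And>i. i \<in> I \<Longrightarrow> finite (A i)"
    and "\<And>J. J \<subseteq> I \<Longrightarrow> card J \<le> card (\<Union>i\<in>J. A i)"
  shows "\<exists>f. inj_on f I \<and> (\<forall>i\<in>I. f i \<in> A i)"
  using assms
proof (induction "card I" arbitrary: I A rule: less_induct)
  case less
  note fin = less.prems(1) and finA = less.prems(2) and hall = less.prems(3)
  show ?case
  proof (cases "I = {}")
    case False
    then obtain i where i: "i \<in> I" by blast
    show ?thesis
    proof (cases "\<exists>K. K \<subseteq> I \<and> K \<noteq> {} \<and> K \<noteq> I \<and> card (\<Union>i\<in>K. A i) = card K")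
      case True
      then obtain K where K: "K \<subseteq> I" "K \<noteq> {}" "K \<noteq> I" "card (\<Union>i\<in>K. A i) = card K" by blast
      let ?B = "\<lambda>j. A j - (\<Union>i\<in>K. A i)"
      have finK: "finite K" using K fin finite_subset by blast
      have cK: "card K < card I" using K fin by (simp add: psubset_card_mono psubset_eq)
      have "\<exists>f. inj_on f K \<and> (\<forall>i\<in>K. f i \<in> A i)"
        by (rule less.hyps[OF cK finK]) (use K finA hall in \<open>auto dest: subset_trans\<close>)
      then obtain f where f: "inj_on f K" "\<forall>i\<in>K. f i \<in> A i" by blast
      have cIK: "card (I - K) < card I" using K fin finK
        by (metis card_Diff_subset card_0_eq card_gt_0_iff card_mono diff_less finite_subset less_le_trans neq0_conv)
      have "\<exists>g. inj_on g (I - K) \<and> (\<forall>i\<in>I - K. g i \<in> ?B i)"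
      proof (rule less.hyps[OF cIK])
        fix J assume J: "J \<subseteq> I - K"
        have finJ: "finite J" using J fin finite_subset by blast
        have fU: "finite (\<Union>i\<in>K. A i)" "finite (\<Union>i\<in>J. A i)"
          using finK finJ finA K J by auto
        \<comment> \<open>Hall's condition survives the deletion of the elements available to
          \<open>K\<close>: apply it to \<open>J \<union> K\<close> and cancel
          \<open>card K\<close>, as \<open>K\<close> is tight.\<close>
        have "card J + card K = card (J \<union> K)"
          using J finJ finK by (subst card_Un_disjoint) auto
        also have "\<dots> \<le> card (\<Union>i\<in>J \<union> K. A i)" using J K by (intro hall) auto
        also have "(\<Union>i\<in>J \<union> K. A i) = (\<Union>j\<in>J. ?B j) \<union> (\<Union>i\<in>K. A i)" by auto
        also have "card \<dots> \<le> card (\<Union>j\<in>J. ?B j) + card (\<Union>i\<in>K. A i)" by (rule card_Un_le)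
        finally show "card J \<le> card (\<Union>j\<in>J. ?B j)" using K by simp
      qed (use fin finA in auto)
      then obtain g where g: "inj_on g (I - K)" "\<forall>i\<in>I - K. g i \<in> ?B i" by blast
      let ?h = "\<lambda>i. if i \<in> K then f i else g i"
      have "inj_on ?h (K \<union> (I - K))"
        unfolding inj_on_def
      proof (intro ballI impI)
        fix a b assume ab: "a \<in> K \<union> (I - K)" "b \<in> K \<union> (I - K)" "?h a = ?h b"
        have "g x \<noteq> f y" if "x \<in> I - K" "y \<in> K" for x y
        proof -
          have "g x \<notin> (\<Union>i\<in>K. A i)" using bspec[OF g(2) that(1)] by simp
          moreover have "f y \<in> (\<Union>i\<in>K. A i)" using f(2) that(2) by auto
          ultimately show ?thesis by metis
        qed
        then show "a = b"
          using ab f(1) g(1) by (cases "a \<in> K"; cases "b \<in> K") (auto dest: inj_onD simp: eq_commute)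
      qed
      moreover have "K \<union> (I - K) = I" using K by blast
      moreover have "\<forall>i\<in>I. ?h i \<in> A i" using f g by auto
      ultimately show ?thesis by (intro exI[of _ ?h]) simp
    next
      case False
      have "card {i} \<le> card (\<Union>j\<in>{i}. A j)" using i by (intro hall) auto
      then obtain x where x: "x \<in> A i" by fastforce
      let ?B = "\<lambda>j. A j - {x}"
      have ci: "card (I - {i}) < card I" using i fin by (meson card_Diff1_less)
      have "\<exists>g. inj_on g (I - {i}) \<and> (\<forall>j\<in>I - {i}. g j \<in> ?B j)"
      proof (rule less.hyps[OF ci])
        fix J assume J: "J \<subseteq> I - {i}"
        show "card J \<le> card (\<Union>j\<in>J. ?B j)"
        proof (cases "J = {}")
          case False
          have JI: "J \<subseteq> I" "J \<noteq> I" using J i by auto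
          have "card J \<noteq> card (\<Union>j\<in>J. A j)"
            using \<open>\<not> (\<exists>K. _ K)\<close> JI False by metis
          then have "card J < card (\<Union>j\<in>J. A j)" using hall[OF JI(1)] by simp
          moreover have "(\<Union>j\<in>J. ?B j) = (\<Union>j\<in>J. A j) - {x}" by auto
          ultimately show ?thesis
            by (metis card_Diff_singleton_if less_imp_le_nat Suc_pred' Suc_leI diff_le_mono diff_Suc_1)
        qed simp
      qed (use fin finA in auto)
      then obtain g where g: "inj_on g (I - {i})" "\<forall>j\<in>I - {i}. g j \<in> ?B j" by blast
      have "inj_on (g(i := x)) (insert i (I - {i}))"
        using g by (subst inj_on_insert) (auto simp: inj_on_def)
      moreover have "insert i (I - {i}) = I" using i by blast
      moreover have "\<forall>j\<in>I. (g(i := x)) j \<in> A j" using g x by auto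
      ultimately show ?thesis by metis
    qed
  qed simp
qed

section \<open>Paths and cycles\<close>

fun path_edges :: "'a list \<Rightarrow> 'a set set" where
  "path_edges (x # y # zs) = insert {x, y} (path_edges (y # zs))"
| "path_edges _ = {}"

text \<open>A list of length at most two gets no closing edge: for two vertices it would repeat the
  path edge, for one it would be a loop. Such a list stands for a path.\<close>

definition cycle_edges :: "'a list \<Rightarrow> 'a set set" where
  "cycle_edges xs = path_edges xs \<union> (if 3 \<le> length xs then {{last xs, hd xs}} else {})"

lemma path_edges_Cons:
  "path_edges (x # xs) = (if xs = [] then {} else insert {x, hd xs} (path_edges xs))"
  by (cases xs) auto

lemma path_edges_append:
  "path_edges (xs @ ys) = path_edges xs \<union> path_edges ys \<union>
     (if xs = [] \<or> ys = [] then {} else {{last xs, hd ys}})"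
  by (induction xs) (auto simp: path_edges_Cons)

lemma path_edges_map: "path_edges (map f xs) = (`) f ` path_edges xs"
  by (induction xs rule: path_edges.induct) auto

lemma cycle_edges_map: "cycle_edges (map f xs) = (`) f ` cycle_edges xs"
  by (cases "xs = []") (auto simp: cycle_edges_def path_edges_map last_map hd_map)

lemma path_edges_take: "path_edges (take k xs) \<subseteq> path_edges xs"
  by (metis append_take_drop_id path_edges_append sup.cobounded1 le_supI1)

lemma path_edges_drop: "path_edges (drop k xs) \<subseteq> path_edges xs"
  by (metis append_take_drop_id path_edges_append sup.cobounded2 le_supI1)

lemma path_edges_interior:
  "xs = ys @ a # u # b # zs \<Longrightarrow> {a, u} \<in> path_edges xs \<and> {u, b} \<in> path_edges xs"
  by (simp add: path_edges_append)

section \<open>Covering a graph of maximum degree two by cycles\<close>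

text \<open>An interior vertex already has its two edges on the path, so a further edge meets the
  path only in end vertices. By maximality its other end is not off the path, hence it joins the two
  ends.\<close>

lemma edges_at_maximal_path:
  assumes E: "E \<subseteq> nsets V 2"
    and deg: "\<And>v. v \<in> V \<Longrightarrow> card {e \<in> E. v \<in> e} \<le> 2" and finE: "finite E"
    and xs: "distinct xs" "set xs \<subseteq> V" "path_edges xs \<subseteq> E"
    and max: "\<And>ys. distinct ys \<Longrightarrow> set ys \<subseteq> V \<Longrightarrow> path_edges ys \<subseteq> E \<Longrightarrow> length ys \<le> length xs"
    and e: "e \<in> E" "e \<inter> set xs \<noteq> {}"
  shows "e \<in> cycle_edges xs"
proof (rule ccontr)
  assume nc: "e \<notin> cycle_edges xs"
  then have np: "e \<notin> path_edges xs" by (simp add: cycle_edges_def)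
  have interior: "v = hd xs \<or> v = last xs" if v: "v \<in> e" "v \<in> set xs" for v
  proof (rule ccontr)
    assume *: "\<not> (v = hd xs \<or> v = last xs)"
    obtain as bs where sp: "xs = as @ v # bs" using v split_list by metis
    have "as \<noteq> []" "bs \<noteq> []" using * sp by auto
    then obtain as' a b bs' where ab: "as = as' @ [a]" "bs = b # bs'"
      by (metis rev_exhaust list.exhaust)
    have sp': "xs = as' @ a # v # b # bs'" using sp ab by simp
    have ed: "{a, v} \<in> E" "{v, b} \<in> E" using path_edges_interior[OF sp'] xs by auto
    have "{a, v} \<noteq> {v, b}" using sp' xs(1) by (auto simp: doubleton_eq_iff)
    moreover have "e \<noteq> {a, v}" "e \<noteq> {v, b}" using path_edges_interior[OF sp'] np by auto
    ultimately have "card {e, {a, v}, {v, b}} = 3" by simp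
    moreover have "card {e, {a, v}, {v, b}} \<le> card {e \<in> E. v \<in> e}"
      using ed e v finE by (intro card_mono) auto
    ultimately show False using deg[of v] v xs by auto
  qed
  obtain u w where uw: "e = {u, w}" "u \<noteq> w" "u \<in> V" "w \<in> V" "u \<in> set xs"
  proof -
    obtain a b where "e = {a, b}" "a \<noteq> b" "a \<in> V" "b \<in> V"
      using e(1) E unfolding nsets_def by (force simp: card_2_iff)
    then show ?thesis using that[of a b] that[of b a] e(2) by (auto simp: insert_commute)
  qed
  have ne: "xs \<noteq> []" using uw by auto
  show False
  proof (cases "w \<in> set xs")
    case True
    then have hl: "e = {last xs, hd xs}" using interior[of u] interior[of w] uw by auto
    show False
    proof (cases "3 \<le> length xs")
      case True then show ?thesis using nc hl by (simp add: cycle_edges_def)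
    next
      \<comment> \<open>On one vertex the edge would be a loop, on two it would be the path edge
        itself.\<close>
      case False
      then consider "length xs = 1" | "length xs = 2" using ne
        by (metis One_nat_def Suc_1 Suc_leI length_0_conv less_antisym not_less numeral_3_eq_3 less_Suc0)
      then show ?thesis
      proof cases
        case 1 then show ?thesis using hl uw by (auto simp: length_Suc_conv)
      next
        case 2
        then obtain a b where "xs = [a, b]" by (metis (no_types) Suc_1 One_nat_def length_0_conv length_Suc_conv)
        then show ?thesis using hl np by (auto simp: insert_commute)
      qed
    qed
  next
    case False
    consider "u = hd xs" | "u = last xs" using interior[of u] uw by auto
    then show False
    proof cases
      case 1
      have "length (w # xs) \<le> length xs"
        by (rule max) (use False 1 xs uw e ne in \<open>auto simp: path_edges_Cons insert_commute\<close>)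
      then show False by simp
    next
      case 2
      have "length (xs @ [w]) \<le> length xs"
        by (rule max) (use False 2 xs uw e ne in \<open>auto simp: path_edges_append\<close>)
      then show False by simp
    qed
  qed
qed

text \<open>Remove a longest path and induct on the vertices left: every edge meeting that path lies
  in its closed-up list, so no edge between pieces is lost.\<close>

lemma path_cycle_cover:
  assumes "finite V" "E \<subseteq> nsets V 2" "\<And>v. v \<in> V \<Longrightarrow> card {e \<in> E. v \<in> e} \<le> 2"
  shows "\<exists>xss. distinct (concat xss) \<and> set (concat xss) = V \<and> (\<forall>e\<in>E. \<exists>xs\<in>set xss. e \<in> cycle_edges xs)"
  using assms
proof (induction "card V" arbitrary: V E rule: less_induct)
  case less
  show ?case
  proof (cases "V = {}")
    case True
    then have "E = {}" using less.prems(2) by (auto simp: nsets_def)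
    then show ?thesis using True by (intro exI[of _ "[]"]) auto
  next
    case False
    then obtain v where v: "v \<in> V" by blast
    have finE: "finite E" using less.prems finite_subset[OF _ finite_imp_finite_nsets] by blast
    define Q where "Q xs \<longleftrightarrow> distinct xs \<and> set xs \<subseteq> V \<and> path_edges xs \<subseteq> E" for xs
    have Q1: "Q [v]" using v by (simp add: Q_def)
    have "length xs \<le> card V" if "Q xs" for xs
      using that less.prems(1) by (metis Q_def card_mono distinct_card)
    then obtain xs where xs: "Q xs" and max: "\<And>ys. Q ys \<Longrightarrow> length ys \<le> length xs"
      using ex_has_greatest_nat[of Q "[v]" length "card V + 1"] Q1 by (metis le_imp_less_Suc Suc_eq_plus1)
    have ne: "xs \<noteq> []" using max[OF Q1] by auto
    have cyc: "e \<in> cycle_edges xs" if "e \<in> E" "e \<inter> set xs \<noteq> {}" for e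
      by (rule edges_at_maximal_path[OF less.prems(2,3) finE]) (use xs max that in \<open>auto simp: Q_def\<close>)
    define E' where "E' = {e \<in> E. e \<inter> set xs = {}}"
    have "\<exists>xss. distinct (concat xss) \<and> set (concat xss) = V - set xs \<and> (\<forall>e\<in>E'. \<exists>xs\<in>set xss. e \<in> cycle_edges xs)"
    proof (rule less.hyps)
      have "set xs \<subseteq> V" "hd xs \<in> set xs" using xs ne by (auto simp: Q_def)
      then have "V - set xs \<subset> V" by blast
      then show "card (V - set xs) < card V"
        using less.prems(1) by (intro psubset_card_mono)
      show "E' \<subseteq> nsets (V - set xs) 2" using less.prems(2) by (auto simp: E'_def nsets_def)
      fix u assume u: "u \<in> V - set xs"
      have "card {e \<in> E'. u \<in> e} \<le> card {e \<in> E. u \<in> e}"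
        using finE by (intro card_mono) (auto simp: E'_def)
      also have "\<dots> \<le> 2" using less.prems(3) u by auto
      finally show "card {e \<in> E'. u \<in> e} \<le> 2" .
    qed (use less.prems in auto)
    then obtain xss where xss: "distinct (concat xss)" "set (concat xss) = V - set xs"
      "\<forall>e\<in>E'. \<exists>xs\<in>set xss. e \<in> cycle_edges xs" by blast
    show ?thesis
    proof (intro exI[of _ "xs # xss"] conjI ballI)
      show "distinct (concat (xs # xss))" using xs xss by (auto simp: Q_def)
      show "set (concat (xs # xss)) = V" using xs xss by (auto simp: Q_def)
      fix e assume "e \<in> E"
      then show "\<exists>ys\<in>set (xs # xss). e \<in> cycle_edges ys"
        using cyc[of e] xss(3) by (cases "e \<inter> set xs = {}") (auto simp: E'_def)
    qed
  qed
qed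

lemma path_edges_concat: "xs \<in> set xss \<Longrightarrow> path_edges xs \<subseteq> path_edges (concat xss)"
  by (induction xss) (auto simp: path_edges_append)

text \<open>Merging all lists of length at most two into one list \<open>s\<close> can only add
  edges, which is harmless because a larger graph is then embedded. If \<open>s\<close> has three or
  more entries it counts as one more cycle and \<open>z\<close> is empty.\<close>

lemma cycle_cover:
  assumes "finite V" "E \<subseteq> nsets V 2" "\<And>v. v \<in> V \<Longrightarrow> card {e \<in> E. v \<in> e} \<le> 2"
  obtains z xss where "distinct (concat (z # xss))" "set (concat (z # xss)) = V"
    "length z \<le> 2" "\<And>xs. xs \<in> set xss \<Longrightarrow> 3 \<le> length xs"
    "\<And>e. e \<in> E \<Longrightarrow> \<exists>xs\<in>set (z # xss). e \<in> cycle_edges xs"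
proof -
  obtain yss where yss: "distinct (concat yss)" "set (concat yss) = V"
    "\<forall>e\<in>E. \<exists>ys\<in>set yss. e \<in> cycle_edges ys"
    using path_cycle_cover[OF assms] by blast
  define s where "s = concat (filter (\<lambda>ys. length ys \<le> 2) yss)"
  define b where "b = filter (\<lambda>ys. \<not> length ys \<le> 2) yss"
  have "mset (s @ concat b) = mset (concat yss)"
    unfolding s_def b_def by (induction yss) auto
  then have d: "distinct (s @ concat b)" and st: "set (s @ concat b) = V"
    using yss mset_eq_imp_distinct_iff[of "s @ concat b" "concat yss"] mset_eq_setD[of "s @ concat b" "concat yss"]
    by simp_all
  have ed: "\<exists>xs\<in>set (s # b). e \<in> cycle_edges xs" if e: "e \<in> E" for e
  proof -
    obtain ys where ys: "ys \<in> set yss" "e \<in> cycle_edges ys" using bspec[OF yss(3) e] by (elim bexE)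
    show ?thesis
    proof (cases "length ys \<le> 2")
      case True
      then have "e \<in> path_edges ys" using ys by (auto simp: cycle_edges_def)
      then have "e \<in> path_edges s"
        unfolding s_def using ys True
        by (intro subsetD[OF path_edges_concat[of ys]]) auto
      then show ?thesis by (auto simp: cycle_edges_def)
    next
      case False then show ?thesis using ys by (auto simp: b_def)
    qed
  qed
  show ?thesis
  proof (cases "length s \<le> 2")
    case True
    show ?thesis
      by (rule that[of s b]) (use d st ed True in \<open>auto simp: b_def\<close>)
  next
    case False
    show ?thesis
      by (rule that[of "[]" "s # b"]) (use d st ed False in \<open>auto simp: b_def\<close>)
  qed
qed

section \<open>Long paths by depth-first search\<close>

text \<open>\<open>D\<close> holds the finished vertices, \<open>xs\<close> is the stack and
  \<open>U\<close> the unvisited vertices. Every move pushes a vertex of \<open>U\<close> or retires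
  the top of the stack to \<open>D\<close>, so \<open>card U - card D\<close> drops by exactly one
  and reaches zero.\<close>

lemma depth_first_search:
  assumes "finite V"
  shows "\<exists>D xs U. D \<union> set xs \<union> U = V \<and> D \<inter> set xs = {} \<and> D \<inter> U = {} \<and> set xs \<inter> U = {} \<and>
    distinct xs \<and> path_edges xs \<subseteq> E \<and> card D = card U \<and> (\<forall>d\<in>D. \<forall>u\<in>U. {d, u} \<notin> E)"
proof -
  define st where "st D xs U \<longleftrightarrow> D \<union> set xs \<union> U = V \<and> D \<inter> set xs = {} \<and> D \<inter> U = {} \<and> set xs \<inter> U = {} \<and>
    distinct xs \<and> path_edges xs \<subseteq> E \<and> (\<forall>d\<in>D. \<forall>u\<in>U. {d, u} \<notin> E)" for D xs U
  have fin: "finite D" "finite U" if "st D xs U" for D xs U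
    using that assms unfolding st_def by (auto dest: finite_subset[rotated])
  \<comment> \<open>\<open>k\<close> is the difference \<open>card U - card D\<close>; it counts
    down from \<open>card V\<close>, where nothing has been visited.\<close>
  have "\<exists>D xs U. st D xs U \<and> card D + k = card U" if "k \<le> card V" for k
    using that
  proof (induction rule: inc_induct)
    case base
    show ?case by (rule exI[of _ "{}"], rule exI[of _ "[]"], rule exI[of _ V]) (auto simp: st_def)
  next
    case (step k)
    then obtain D xs U where s: "st D xs U" and c: "card D + Suc k = card U" by blast
    note fin = fin[OF s]
    show ?case
    proof (cases "xs = [] \<or> (\<exists>u\<in>U. {last xs, u} \<in> E)")
      case True
      then obtain u where u: "u \<in> U" "xs = [] \<or> {last xs, u} \<in> E"
        using c fin by (metis card.empty add_is_0 all_not_in_conv old.nat.distinct(1))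
      have "st D (xs @ [u]) (U - {u})"
        using s u unfolding st_def by (auto simp: path_edges_append)
      moreover have "card D + k = card (U - {u})" using c u fin by simp
      ultimately show ?thesis by blast
    next
      \<comment> \<open>The top of the stack has no neighbour left in \<open>U\<close>, so moving it
        to \<open>D\<close> creates no edge between \<open>D\<close> and \<open>U\<close>.\<close>
      case False
      define x ys where "x = last xs" and "ys = butlast xs"
      have xs: "xs = ys @ [x]" using False by (simp add: x_def ys_def)
      have x: "x \<notin> D" using s xs by (auto simp: st_def)
      have "st (insert x D) ys U"
        using s False unfolding st_def xs by (auto simp: path_edges_append)
      moreover have "card (insert x D) + k = card U" using c fin x by simp
      ultimately show ?thesis by blast
    qed
  qed
  from this[of 0] obtain D xs U where "st D xs U" "card D = card U" by auto
  then show ?thesis unfolding st_def by blast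
qed

text \<open>The search ends with two sets of equal size and no edge between them. Expansion makes
  each smaller than \<open>k\<close>, so at most \<open>2 * (k - 1)\<close> vertices are off the
  path.\<close>

lemma long_path:
  assumes fin: "finite V"
    and exp: "\<And>D U. D \<subseteq> V \<Longrightarrow> U \<subseteq> V \<Longrightarrow> D \<inter> U = {} \<Longrightarrow> card D = k \<Longrightarrow> card U = k \<Longrightarrow>
      \<exists>d\<in>D. \<exists>u\<in>U. {d, u} \<in> E"
    and l: "l + 2 * k \<le> card V + 2"
  obtains xs where "distinct xs" "set xs \<subseteq> V" "path_edges xs \<subseteq> E" "length xs = l"
proof -
  obtain D xs U where *: "D \<union> set xs \<union> U = V" "D \<inter> set xs = {}" "D \<inter> U = {}" "set xs \<inter> U = {}"
    "distinct xs" "path_edges xs \<subseteq> E" "card D = card U" "\<forall>d\<in>D. \<forall>u\<in>U. {d, u} \<notin> E"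
    using depth_first_search[OF fin] by metis
  have finDU: "finite D" "finite U" using * fin by (auto dest: finite_subset[rotated])
  have "card D < k"
  proof (rule ccontr)
    assume "\<not> card D < k"
    then obtain D' U' where "D' \<subseteq> D" "card D' = k" "U' \<subseteq> U" "card U' = k"
      using *(7) by (metis not_less obtain_subset_with_card_n)
    moreover from this have "\<exists>d\<in>D'. \<exists>u\<in>U'. {d, u} \<in> E" using * by (intro exp) auto
    ultimately show False using *(8) by blast
  qed
  moreover have "card V = card D + length xs + card U"
    using * finDU by (metis card_Un_disjoint distinct_card finite_Un finite_set Int_Un_distrib2 Un_empty)
  ultimately have "l \<le> length xs" using l *(7) by linarith
  then show ?thesis
    using * by (intro that[of "take l xs"]) (auto dest: in_set_takeD subsetD[OF path_edges_take])
qed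

section \<open>Matchings by cherries in a random graph\<close>

text \<open>The pairs need not be edges: each is a gap to be closed by a further vertex adjacent to
  both members.\<close>

definition matching :: "('a \<times> 'a) set \<Rightarrow> bool" where
  "matching P \<longleftrightarrow> inj_on fst P \<and> inj_on snd P \<and> fst ` P \<inter> snd ` P = {}"

definition ends :: "('a \<times> 'a) set \<Rightarrow> 'a set" where
  "ends P = fst ` P \<union> snd ` P"

section \<open>Probability that no member of a disjoint family of edge sets is present\<close>

lemma measure_pair_pmf_Times:
  "measure_pmf.prob (pair_pmf M N) (A \<times> B) = measure_pmf.prob M A * measure_pmf.prob N B"
proof -
  \<comment> \<open>The product rule is applied to countable sets, hence the restriction to the
    supports.\<close>
  have "measure_pmf.prob (pair_pmf M N) (A \<times> B)
      = measure_pmf.prob (pair_pmf M N) ((A \<inter> set_pmf M) \<times> (B \<inter> set_pmf N))"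
    by (intro measure_prob_cong_0) (auto simp: pmf_pair set_pmf_iff)
  also have "\<dots> = measure_pmf.prob M (A \<inter> set_pmf M) * measure_pmf.prob N (B \<inter> set_pmf N)"
    by (rule measure_pmf_prob_product) (auto intro: countable_subset)
  finally show ?thesis by (simp add: measure_Int_set_pmf)
qed

text \<open>Disjoint blocks depend on disjoint sets of coordinates, so the events are independent;
  the induction splits off the coordinates of one block at a time. Blocks will be single edges
  (\<open>c = 1\<close>) or cherries (\<open>c = 2\<close>).\<close>

lemma prob_no_block_full:
  assumes q: "0 \<le> q" "q \<le> 1"
    and "finite A" "finite I" "\<And>i. i \<in> I \<Longrightarrow> B i \<subseteq> A" "disjoint_family_on B I" "\<And>i. i \<in> I \<Longrightarrow> card (B i) = c"
  shows "measure_pmf.prob (Pi_pmf A False (\<lambda>_. bernoulli_pmf q)) {f. \<forall>i\<in>I. \<not> (\<forall>e\<in>B i. f e)}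
    = (1 - q ^ c) ^ card I"
  using assms(4,3,5-7)
proof (induction I arbitrary: A rule: finite_induct)
  case empty
  then show ?case by simp
next
  case (insert j I)
  let ?D = "\<lambda>A. Pi_pmf A False (\<lambda>_. bernoulli_pmf q)"
  have fin: "finite (B j)" "finite (A - B j)" using insert.prems finite_subset by blast+
  have dis: "B i \<inter> B j = {}" if "i \<in> I" for i
    using insert.prems(3) insert.hyps that unfolding disjoint_family_on_def by auto
  have A: "A = B j \<union> (A - B j)" using insert.prems by blast
  have "?D A = map_pmf (\<lambda>(f, g) x. if x \<in> B j then f x else g x) (pair_pmf (?D (B j)) (?D (A - B j)))"
    by (subst A, rule Pi_pmf_union) (use fin in auto)
  then have "measure_pmf.prob (?D A) {f. \<forall>i\<in>insert j I. \<not> (\<forall>e\<in>B i. f e)}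
    = measure_pmf.prob (pair_pmf (?D (B j)) (?D (A - B j)))
       ((\<lambda>(f, g) x. if x \<in> B j then f x else g x) -` {f. \<forall>i\<in>insert j I. \<not> (\<forall>e\<in>B i. f e)})"
    by simp
  also have "(\<lambda>(f, g) x. if x \<in> B j then f x else g x) -` {f. \<forall>i\<in>insert j I. \<not> (\<forall>e\<in>B i. f e)}
     = {f. \<not> (\<forall>e\<in>B j. f e)} \<times> {g. \<forall>i\<in>I. \<not> (\<forall>e\<in>B i. g e)}" (is "?L = ?R")
  proof -
    have *: "(\<forall>e\<in>B i. if e \<in> B j then f e else g e) \<longleftrightarrow> (\<forall>e\<in>B i. g e)" if "i \<in> I" for i and f g :: "'a \<Rightarrow> bool"
      by (intro ball_cong refl) (use dis[OF that] in auto)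
    have "(\<forall>i\<in>I. \<not> (\<forall>e\<in>B i. if e \<in> B j then f e else g e)) \<longleftrightarrow> (\<forall>i\<in>I. \<not> (\<forall>e\<in>B i. g e))"
      for f g :: "'a \<Rightarrow> bool" by (rule ball_cong[OF refl]) (simp only: *)
    then have "(f, g) \<in> ?L \<longleftrightarrow> (f, g) \<in> ?R" for f g
      by (simp del: not_all)
    then show ?thesis by (simp only: set_eq_iff split_paired_All) blast
  qed
  also have "measure_pmf.prob (pair_pmf (?D (B j)) (?D (A - B j))) \<dots>
     = measure_pmf.prob (?D (B j)) {f. \<not> (\<forall>e\<in>B j. f e)} *
       measure_pmf.prob (?D (A - B j)) {g. \<forall>i\<in>I. \<not> (\<forall>e\<in>B i. g e)}"
    by (rule measure_pair_pmf_Times)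
  also have "measure_pmf.prob (?D (A - B j)) {g. \<forall>i\<in>I. \<not> (\<forall>e\<in>B i. g e)} = (1 - q ^ c) ^ card I"
  proof (rule insert.IH)
    show "B i \<subseteq> A - B j" if "i \<in> I" for i using dis[OF that] insert.prems(2) that by blast
    show "disjoint_family_on B I"
      using insert.prems(3) by (rule disjoint_family_on_mono[rotated]) auto
  qed (use fin insert.prems in auto)
  also have "measure_pmf.prob (?D (B j)) {f. \<not> (\<forall>e\<in>B j. f e)} = 1 - q ^ c"
  proof -
    have "{f. \<forall>e\<in>B j. f e} = Pi (B j) (\<lambda>_. {True})" by auto
    then have "measure_pmf.prob (?D (B j)) {f. \<forall>e\<in>B j. f e} = q ^ c"
      using measure_Pi_pmf_Pi[OF fin(1), of False "\<lambda>_. bernoulli_pmf q" "\<lambda>_. {True}"] q insert.prems(4)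
      by (simp add: measure_pmf_single)
    moreover have "{f. \<not> (\<forall>e\<in>B j. f e)} = UNIV - {f. \<forall>e\<in>B j. f e}" by auto
    ultimately show ?thesis
      using measure_pmf.prob_compl[of "{f. \<forall>e\<in>B j. f e}" "?D (B j)"] by simp
  qed
  finally show ?case using insert.hyps by simp
qed

corollary prob_no_block_full_le:
  assumes q: "0 \<le> q" "q \<le> 1"
    and "finite A" "finite I" "\<And>i. i \<in> I \<Longrightarrow> B i \<subseteq> A" "disjoint_family_on B I" "\<And>i. i \<in> I \<Longrightarrow> card (B i) = c"
  shows "measure_pmf.prob (Pi_pmf A False (\<lambda>_. bernoulli_pmf q)) {f. \<forall>i\<in>I. \<not> (\<forall>e\<in>B i. f e)}
    \<le> exp (- (q ^ c * real (card I)))"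
proof -
  have "(1 - q ^ c) ^ card I \<le> exp (- (q ^ c)) ^ card I"
    using exp_ge_add_one_self[of "- (q ^ c)"] q by (intro power_mono) (auto simp: power_le_one)
  also have "\<dots> = exp (- (q ^ c * real (card I)))"
    by (simp add: exp_of_nat_mult[symmetric] mult.commute)
  finally show ?thesis using prob_no_block_full[OF assms] by simp
qed

lemma measure_pmf_UNION_le:
  assumes "finite I" "\<And>i. i \<in> I \<Longrightarrow> measure_pmf.prob M (F i) \<le> c"
  shows "measure_pmf.prob M (\<Union>i\<in>I. F i) \<le> real (card I) * c"
proof -
  have "measure_pmf.prob M (\<Union>i\<in>I. F i) \<le> (\<Sum>i\<in>I. measure_pmf.prob M (F i))"
    by (rule measure_UNION_le) (use assms in auto)
  also have "\<dots> \<le> real (card I) * c" using sum_bounded_above[of I _ c] assms(2) by metis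
  finally show ?thesis .
qed

lemma measure_pmf_Un_le:
  "measure_pmf.prob M (A \<union> B) \<le> measure_pmf.prob M A + measure_pmf.prob M B"
  by (rule measure_Un_le) auto

lemma card_subsets_le_power:
  assumes "finite A" shows "card {S. S \<subseteq> A \<and> card S = s} \<le> card A ^ s"
proof -
  have "card A choose s \<le> card A ^ s"
  proof (cases "s \<le> card A")
    case True then show ?thesis by (rule binomial_le_pow)
  next
    case False then show ?thesis by (simp add: binomial_eq_0)
  qed
  then show ?thesis by (simp only: n_subsets[OF assms])
qed

lemma prob_no_edge_between:
  fixes n :: nat
  assumes q: "0 \<le> q" "q \<le> 1"
    and DU: "D \<subseteq> {..<n}" "U \<subseteq> {..<n}" "D \<inter> U = {}"
  shows "measure_pmf.prob (Pi_pmf (nsets {..<n} 2) False (\<lambda>_. bernoulli_pmf q)) {f. \<forall>d\<in>D. \<forall>u\<in>U. \<not> f {d, u}}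
    \<le> exp (- (q * real (card D * card U)))"
proof -
  let ?B = "\<lambda>(d, u). {{d, u}}"
  have fin: "finite (D \<times> U)"
    using finite_subset[OF DU(1)] finite_subset[OF DU(2)] by simp
  have "measure_pmf.prob (Pi_pmf (nsets {..<n} 2) False (\<lambda>_. bernoulli_pmf q)) {f. \<forall>i\<in>D \<times> U. \<not> (\<forall>e\<in>?B i. f e)}
    \<le> exp (- (q ^ 1 * real (card (D \<times> U))))"
  proof (rule prob_no_block_full_le[OF q])
    show "finite ([{..<n}]\<^bsup>2\<^esup>)" by (simp add: finite_imp_finite_nsets)
    show "disjoint_family_on ?B (D \<times> U)"
      unfolding disjoint_family_on_def
    proof (intro ballI impI)
      fix i j assume ij: "i \<in> D \<times> U" "j \<in> D \<times> U" "i \<noteq> j"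
      obtain a b c d where i: "i = (a, b)" and j: "j = (c, d)" by (metis prod.exhaust)
      \<comment> \<open>As \<open>D\<close> and \<open>U\<close> are disjoint, no edge arises from
        two pairs in opposite orientations.\<close>
      have "a \<noteq> d" "b \<noteq> c" using ij i j DU(3) by auto
      then show "?B i \<inter> ?B j = {}" using ij(3) i j by (auto simp: doubleton_eq_iff)
    qed
    show "?B i \<subseteq> [{..<n}]\<^bsup>2\<^esup>" if "i \<in> D \<times> U" for i
      using that DU by (auto simp: nsets_def card_insert_if)
  qed (use fin in auto)
  then show ?thesis by (simp add: card_cartesian_product)
qed

lemma prob_not_expanding:
  fixes n :: nat
  assumes q: "0 \<le> q" "q \<le> 1"
  shows "measure_pmf.prob (Pi_pmf (nsets {..<n} 2) False (\<lambda>_. bernoulli_pmf q))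
    {f. \<exists>D U. D \<subseteq> {..<n} \<and> U \<subseteq> {..<n} \<and> D \<inter> U = {} \<and> card D = k \<and> card U = k \<and> (\<forall>d\<in>D. \<forall>u\<in>U. \<not> f {d, u})}
    \<le> 4 ^ n * exp (- (q * real (k * k)))"
proof -
  let ?D = "Pi_pmf (nsets {..<n} 2) False (\<lambda>_. bernoulli_pmf q)"
  let ?I = "{(D, U). D \<subseteq> {..<n} \<and> U \<subseteq> {..<n} \<and> D \<inter> U = {} \<and> card D = k \<and> card U = k}"
  have sub: "?I \<subseteq> Pow {..<n} \<times> Pow {..<n}" by auto
  have finI: "finite ?I" by (rule finite_subset[OF sub]) auto
  \<comment> \<open>Ignoring sizes leaves \<open>4 ^ n\<close> pairs; an exponent of order
    \<open>n ln n\<close> will outweigh this crude count.\<close>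
  have "card ?I \<le> card (Pow {..<n} \<times> Pow {..<n})" by (rule card_mono[OF _ sub]) auto
  also have "\<dots> = 4 ^ n" by (simp add: card_cartesian_product card_Pow flip: power_mult_distrib)
  finally have cI: "real (card ?I) \<le> 4 ^ n" by (simp flip: of_nat_power)
  have "measure_pmf.prob ?D (\<Union>(D, U)\<in>?I. {f. \<forall>d\<in>D. \<forall>u\<in>U. \<not> f {d, u}})
    \<le> real (card ?I) * exp (- (q * real (k * k)))"
  proof (rule measure_pmf_UNION_le[OF finI])
    fix i assume "i \<in> ?I"
    then obtain D U where "i = (D, U)" "D \<subseteq> {..<n}" "U \<subseteq> {..<n}" "D \<inter> U = {}" "card D = k" "card U = k"
      by blast
    then show "measure_pmf.prob ?D (case i of (D, U) \<Rightarrow> {f. \<forall>d\<in>D. \<forall>u\<in>U. \<not> f {d, u}}) \<le> exp (- (q * real (k * k)))"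
      using prob_no_edge_between[OF q, of D n U] by simp
  qed
  also have "\<dots> \<le> 4 ^ n * exp (- (q * real (k * k)))"
    using cI by (intro mult_right_mono) auto
  also have "(\<Union>(D, U)\<in>?I. {f. \<forall>d\<in>D. \<forall>u\<in>U. \<not> f {d, u}}) =
    {f. \<exists>D U. D \<subseteq> {..<n} \<and> U \<subseteq> {..<n} \<and> D \<inter> U = {} \<and> card D = k \<and> card U = k \<and> (\<forall>d\<in>D. \<forall>u\<in>U. \<not> f {d, u})}"
    by auto
  finally show ?thesis .
qed

definition no_cherry :: "('a set \<Rightarrow> bool) \<Rightarrow> ('a \<times> 'a) set \<Rightarrow> 'a set \<Rightarrow> bool" where
  "no_cherry g S T \<longleftrightarrow> (\<forall>(a, b)\<in>S. \<forall>x\<in>T. \<not> (g {a, x} \<and> g {b, x}))"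

text \<open>Since \<open>S\<close> is a matching whose ends avoid \<open>T\<close>, the cherries of
  different elements of \<open>S \<times> T\<close> share no edge, and the block bound applies with
  two edges per block.\<close>

lemma prob_no_cherry:
  fixes n :: nat
  assumes q: "0 \<le> q" "q \<le> 1"
    and ST: "S \<subseteq> {..<n} \<times> {..<n}" "matching S" "T \<subseteq> {..<n}" "ends S \<inter> T = {}"
  shows "measure_pmf.prob (Pi_pmf (nsets {..<n} 2) False (\<lambda>_. bernoulli_pmf q)) {g. no_cherry g S T}
    \<le> exp (- (q\<^sup>2 * real (card S * card T)))"
proof -
  let ?B = "\<lambda>((a, b), x). {{a, x}, {b, x}}"
  have fin: "finite (S \<times> T)"
    using finite_subset[OF ST(1)] finite_subset[OF ST(3)] by simp
  have ne: "a \<noteq> b" "x \<noteq> a" "x \<noteq> b" "a < n" "b < n" "x < n" if "(a, b) \<in> S" "x \<in> T" for a b x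
    using that ST by (force simp: matching_def ends_def)+
  have "measure_pmf.prob (Pi_pmf (nsets {..<n} 2) False (\<lambda>_. bernoulli_pmf q)) {f. \<forall>i\<in>S \<times> T. \<not> (\<forall>e\<in>?B i. f e)}
    \<le> exp (- (q ^ 2 * real (card (S \<times> T))))"
  proof (rule prob_no_block_full_le[OF q])
    show "finite ([{..<n}]\<^bsup>2\<^esup>)" by (simp add: finite_imp_finite_nsets)
    show "disjoint_family_on ?B (S \<times> T)"
      unfolding disjoint_family_on_def
    proof (intro ballI impI)
      fix i j assume ij: "i \<in> S \<times> T" "j \<in> S \<times> T" "i \<noteq> j"
      obtain a b x c d y where i: "i = ((a, b), x)" and j: "j = ((c, d), y)" by (metis prod.exhaust)
      have S: "(a, b) \<in> S" "(c, d) \<in> S" and T: "x \<in> T" "y \<in> T" using ij i j by auto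
      have cd: "c \<notin> T" "d \<notin> T" "a \<notin> T" "b \<notin> T" using S ST(4) by (force simp: ends_def)+
      have "a \<noteq> d" "b \<noteq> c" using S ST(2) by (force simp: matching_def)+
      moreover have "a = c \<Longrightarrow> b = d" "b = d \<Longrightarrow> a = c"
        using S ST(2) inj_onD[of fst S "(a, b)" "(c, d)"] inj_onD[of snd S "(a, b)" "(c, d)"]
        by (auto simp: matching_def)
      ultimately show "?B i \<inter> ?B j = {}"
        using ij(3) cd T i j by (auto simp: doubleton_eq_iff)
    qed
    show "?B i \<subseteq> [{..<n}]\<^bsup>2\<^esup>" "card (?B i) = 2" if "i \<in> S \<times> T" for i
    proof -
      obtain a b x where i: "i = ((a, b), x)" "(a, b) \<in> S" "x \<in> T" using \<open>i \<in> S \<times> T\<close> by force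
      note ne = ne[OF i(2,3)]
      show "?B i \<subseteq> [{..<n}]\<^bsup>2\<^esup>" using ne i by (auto simp: nsets_def card_insert_if)
      show "card (?B i) = 2" using ne i by (simp add: card_insert_if doubleton_eq_iff)
    qed
  qed (use fin in auto)
  moreover have "{f. \<forall>i\<in>S \<times> T. \<not> (\<forall>e\<in>?B i. f e)} = {g. no_cherry g S T}"
    by (auto simp: no_cherry_def)
  ultimately show ?thesis by (simp add: card_cartesian_product)
qed

text \<open>A violator \<open>J\<close> of Hall's condition has no cherry with
  \<open>T = R - N\<close>, where \<open>N\<close> is its neighbourhood and
  \<open>card N < card J\<close>. If \<open>J\<close> is small, it misses all but at most
  \<open>card J\<close> vertices of the fixed set \<open>Y\<close>; if \<open>T\<close> is small, it
  misses all but at most \<open>card T\<close> pairs of the fixed \<open>M\<close>; otherwise both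
  contain sets of size \<open>k\<close>.\<close>

lemma hall_from_cherries:
  assumes M: "finite M" "card M = m" and Y: "finite Y" "card Y = m" and k: "k \<le> m"
    and V: "finite V"
    and left: "\<And>S Z. S \<subseteq> V \<times> V \<Longrightarrow> matching S \<Longrightarrow> ends S \<inter> Y = {} \<Longrightarrow> Z \<subseteq> Y \<Longrightarrow> card Z = card S \<Longrightarrow>
      card S \<in> {1..k} \<Longrightarrow> \<not> no_cherry g S (Y - Z)"
    and right: "\<And>Z T. Z \<subseteq> M \<Longrightarrow> T \<subseteq> V \<Longrightarrow> ends M \<inter> T = {} \<Longrightarrow> card Z = card T \<Longrightarrow>
      card T \<in> {1..k} \<Longrightarrow> \<not> no_cherry g (M - Z) T"
    and mid: "\<And>S T. S \<subseteq> V \<times> V \<Longrightarrow> matching S \<Longrightarrow> T \<subseteq> V \<Longrightarrow> ends S \<inter> T = {} \<Longrightarrow>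
      card S = k \<Longrightarrow> card T = k \<Longrightarrow> \<not> no_cherry g S T"
    and P: "M \<subseteq> P" "P \<subseteq> V \<times> V" "matching P"
    and R: "Y \<subseteq> R" "R \<subseteq> V" "ends P \<inter> R = {}" "card P = card R"
  shows "\<exists>f. bij_betw f P R \<and> (\<forall>(a, b)\<in>P. g {a, f (a, b)} \<and> g {b, f (a, b)})"
proof -
  define A where "A p = {x \<in> R. g {fst p, x} \<and> g {snd p, x}}" for p
  have fin: "finite P" "finite R" using P R V by (auto intro: finite_subset)
  have sub: "matching S" "ends S \<subseteq> ends P" if "S \<subseteq> P" for S
    using that P(3) by (auto simp: matching_def ends_def intro: inj_on_subset)
  have mono: "no_cherry g S' T'" if "no_cherry g S T" "S' \<subseteq> S" "T' \<subseteq> T" for S T S' T'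
    using that unfolding no_cherry_def by blast
  have "\<exists>f. inj_on f P \<and> (\<forall>p\<in>P. f p \<in> A p)"
  proof (rule hall_marriage)
    fix J assume J: "J \<subseteq> P"
    show "card J \<le> card (\<Union>p\<in>J. A p)"
    proof (rule ccontr)
      assume less: "\<not> card J \<le> card (\<Union>p\<in>J. A p)"
      define N T where "N = (\<Union>p\<in>J. A p)" and "T = R - N"
      have NR: "N \<subseteq> R" by (auto simp: N_def A_def)
      have finJ: "finite J" "finite N" "finite T" using J fin NR by (auto simp: T_def intro: finite_subset)
      have nc: "no_cherry g J T"
        unfolding no_cherry_def T_def N_def A_def by force
      have cN: "card N < card J" using less by (simp add: N_def)
      have cT: "card T = card R - card N" unfolding T_def using NR finJ by (simp add: card_Diff_subset)
      have cJ: "card J \<le> card P" using J fin card_mono by blast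
      have JV: "J \<subseteq> V \<times> V" "T \<subseteq> V" "ends J \<inter> T = {}" "ends M \<inter> T = {}" "ends J \<inter> Y = {}"
        using J P R sub[OF J] sub[OF P(1)] by (auto simp: T_def)
      consider "card J \<le> k" | "card T \<le> k" | "k \<le> card J" "k \<le> card T" by linarith
      then show False
      proof cases
        case 1
        have "card (Y \<inter> N) \<le> card J" using cN card_mono[of N "Y \<inter> N"] finJ by simp
        \<comment> \<open>The exceptional set is padded to exactly \<open>card J\<close> elements,
          so that the union bound involves one size only.\<close>
        then obtain Z where Z: "Y \<inter> N \<subseteq> Z" "Z \<subseteq> Y" "card Z = card J"
          using exists_subset_between[of "Y \<inter> N" "card J" Y] 1 k Y by auto
        have "no_cherry g J (Y - Z)" by (rule mono[OF nc]) (use Z R(1) in \<open>auto simp: T_def\<close>)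
        moreover have "card J \<in> {1..k}" using 1 cN by auto
        ultimately show False using left[OF JV(1) sub(1)[OF J] JV(5) Z(2,3)] by blast
      next
        case 2
        \<comment> \<open>The pairs of \<open>M\<close> outside \<open>J\<close> are few enough to
          be discarded with \<open>Z\<close>; what remains of \<open>M\<close> lies in
          \<open>J\<close>.\<close>
        have "card (M - J) \<le> card (P - J)" using fin P(1) by (intro card_mono) auto
        also have "\<dots> = card P - card J" using J finJ by (simp add: card_Diff_subset)
        also have "\<dots> \<le> card T" using cT cN R(4) by simp
        finally obtain Z where Z: "M - J \<subseteq> Z" "Z \<subseteq> M" "card Z = card T"
          using exists_subset_between[of "M - J" "card T" M] 2 k M by auto
        have "no_cherry g (M - Z) T" by (rule mono[OF nc]) (use Z in auto)
        moreover have "card T \<in> {1..k}" using 2 cN cT cJ R(4) by auto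
        ultimately show False using right[OF Z(2) JV(2,4) Z(3)] by blast
      next
        case 3
        obtain S where S: "S \<subseteq> J" "card S = k" using 3 by (metis obtain_subset_with_card_n)
        obtain T' where T': "T' \<subseteq> T" "card T' = k" using 3 by (metis obtain_subset_with_card_n)
        have "\<not> no_cherry g S T'"
        proof (rule mid)
          show "matching S" by (rule sub) (use S J in blast)
          have "ends S \<subseteq> ends J" using S by (auto simp: ends_def)
          then show "ends S \<inter> T' = {}" using JV(3) T'(1) by blast
        qed (use S T' JV in blast)+
        then show False using mono[OF nc S(1) T'(1)] by blast
      qed
    qed
  qed (use fin in \<open>auto simp: A_def\<close>)
  then obtain f where f: "inj_on f P" "\<forall>p\<in>P. f p \<in> A p" by blast
  have "f ` P \<subseteq> R" using f by (auto simp: A_def)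
  then have "f ` P = R" using f(1) fin R(4) by (intro card_subset_eq) (auto simp: card_image)
  then have "bij_betw f P R" using f(1) by (simp add: bij_betw_def)
  moreover have "\<forall>(a, b)\<in>P. g {a, f (a, b)} \<and> g {b, f (a, b)}" using f(2) by (force simp: A_def)
  ultimately show ?thesis by blast
qed

text \<open>The exponent \<open>3 * s\<close> allows a choice of \<open>s\<close> pairs and
  \<open>s\<close> vertices. The union bound is then the \<open>s\<close>-th power of the final
  bound, which is at most 1, so all sizes \<open>s\<close> get the same estimate.\<close>

lemma prob_no_cherry_family:
  fixes n :: nat
  assumes q: "0 \<le> q" "q \<le> 1"
    and F: "finite F" "real (card F) \<le> real n ^ (3 * s)" and s: "1 \<le> s" and m: "0 \<le> m"
    and ST: "\<And>S T. (S, T) \<in> F \<Longrightarrow> S \<subseteq> {..<n} \<times> {..<n} \<and> matching S \<and> T \<subseteq> {..<n} \<and> ends S \<inter> T = {} \<and>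
      real s * m \<le> real (card S * card T)"
    and small: "real n ^ 3 * exp (- (q\<^sup>2 * m)) \<le> 1"
  shows "measure_pmf.prob (Pi_pmf (nsets {..<n} 2) False (\<lambda>_. bernoulli_pmf q)) {g. \<exists>(S, T)\<in>F. no_cherry g S T}
    \<le> real n ^ 3 * exp (- (q\<^sup>2 * m))"
proof -
  let ?D = "Pi_pmf (nsets {..<n} 2) False (\<lambda>_. bernoulli_pmf q)"
  let ?x = "real n ^ 3 * exp (- (q\<^sup>2 * m))"
  have "measure_pmf.prob ?D (\<Union>(S, T)\<in>F. {g. no_cherry g S T}) \<le> real (card F) * exp (- (q\<^sup>2 * (real s * m)))"
  proof (rule measure_pmf_UNION_le[OF F(1)])
    fix i assume "i \<in> F"
    then obtain S T where i: "i = (S, T)" "(S, T) \<in> F" by (cases i) auto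
    have "measure_pmf.prob ?D {g. no_cherry g S T} \<le> exp (- (q\<^sup>2 * real (card S * card T)))"
      using ST[OF i(2)] by (intro prob_no_cherry q) auto
    also have "\<dots> \<le> exp (- (q\<^sup>2 * (real s * m)))"
      using ST[OF i(2)] by (simp add: mult_left_mono)
    finally show "measure_pmf.prob ?D (case i of (S, T) \<Rightarrow> {g. no_cherry g S T}) \<le> exp (- (q\<^sup>2 * (real s * m)))"
      using i by simp
  qed
  also have "\<dots> \<le> real n ^ (3 * s) * exp (- (q\<^sup>2 * (real s * m)))"
    using F(2) by (intro mult_right_mono) auto
  also have "\<dots> = ?x ^ s"
    by (simp add: power_mult power_mult_distrib exp_of_nat_mult[symmetric] mult.left_commute)
  also have "\<dots> \<le> ?x ^ 1"
    using s small by (intro power_decreasing) auto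
  also have "(\<Union>(S, T)\<in>F. {g. no_cherry g S T}) = {g. \<exists>(S, T)\<in>F. no_cherry g S T}" by auto
  finally show ?thesis by simp
qed

text \<open>The quantifiers over \<open>P\<close> and \<open>R\<close> are inside the event: one
  outcome \<open>g\<close> serves every graph to be embedded whose matching problem extends
  \<open>M\<close> and \<open>Y\<close>.\<close>

definition cherry_matchable :: "nat \<Rightarrow> nat set \<Rightarrow> (nat \<times> nat) set \<Rightarrow> (nat set \<Rightarrow> bool) \<Rightarrow> bool" where
  "cherry_matchable n Y M g \<longleftrightarrow> (\<forall>P R. M \<subseteq> P \<longrightarrow> P \<subseteq> {..<n} \<times> {..<n} \<longrightarrow> matching P \<longrightarrow>
     Y \<subseteq> R \<longrightarrow> R \<subseteq> {..<n} \<longrightarrow> ends P \<inter> R = {} \<longrightarrow> card P = card R \<longrightarrow>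
     (\<exists>f. bij_betw f P R \<and> (\<forall>(a, b)\<in>P. g {a, f (a, b)} \<and> g {b, f (a, b)})))"

text \<open>A failure yields one of \<open>2 * k + 1\<close> kinds of missing cherries: small sets
  of pairs against most of \<open>Y\<close>, small sets of vertices against most of
  \<open>M\<close>, or two sets of size \<open>k\<close>. Each kind costs \<open>n ^ 3\<close> times
  the exponential, and their number gives the fourth factor \<open>n\<close>.\<close>

lemma prob_not_cherry_matchable:
  assumes q: "0 \<le> q" "q \<le> 1"
    and M: "M \<subseteq> {..<n} \<times> {..<n}" "card M = m" "matching M"
    and Y: "Y \<subseteq> {..<n}" "card Y = m" and m: "3 \<le> m" and mn: "m < n"
  shows "measure_pmf.prob (Pi_pmf (nsets {..<n} 2) False (\<lambda>_. bernoulli_pmf q)) {g. \<not> cherry_matchable n Y M g}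
    \<le> real n ^ 4 * exp (- (q\<^sup>2 * (real m / 3)))" (is "measure_pmf.prob ?D _ \<le> _")
proof (cases "real n ^ 3 * exp (- (q\<^sup>2 * (real m / 3))) \<le> 1")
  \<comment> \<open>Here the claimed bound is at least 1, so there is nothing to estimate.\<close>
  case False
  have "1 \<le> real n" using mn by simp
  then have "1 \<le> real n * (real n ^ 3 * exp (- (q\<^sup>2 * (real m / 3))))"
    using False mult_mono[of 1 "real n" 1 "real n ^ 3 * exp (- (q\<^sup>2 * (real m / 3)))"] by simp
  also have "\<dots> = real n ^ 4 * exp (- (q\<^sup>2 * (real m / 3)))" by (simp add: power_Suc[symmetric] eval_nat_numeral)
  finally show ?thesis using measure_pmf.prob_le_1 order_trans by blast
next
  case True
  let ?x = "real n ^ 3 * exp (- (q\<^sup>2 * (real m / 3)))"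
  let ?V = "{..<n} :: nat set"
  \<comment> \<open>Halving keeps both \<open>k\<close> and \<open>m - k\<close> at least
    \<open>m / 3\<close>, so the larger side of each forbidden pair of sets has at least
    \<open>m / 3\<close> elements.\<close>
  define k where "k = m div 2"
  have k: "1 \<le> k" "k \<le> m" "real m / 3 \<le> real k" "real m / 3 \<le> real (m - k)" using m by (auto simp: k_def)
  have finM: "finite M" "finite Y" using M Y by (auto intro: finite_subset)
  let ?SS = "\<lambda>s. {S. S \<subseteq> ?V \<times> ?V \<and> card S = s}"
  let ?TT = "\<lambda>A s. {T. T \<subseteq> A \<and> card T = s}"
  \<comment> \<open>The three families match the hypotheses \<open>left\<close>,
    \<open>right\<close> and \<open>mid\<close> of \<open>hall_from_cherries\<close>. The large side
    in \<open>F1\<close> and \<open>F2\<close> is determined by the small set \<open>Z\<close>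
    removed from it, which keeps the families small.\<close>
  define F1 where "F1 s = {(S, T). S \<subseteq> ?V \<times> ?V \<and> matching S \<and> ends S \<inter> Y = {} \<and> card S = s \<and>
    (\<exists>Z. Z \<subseteq> Y \<and> card Z = s \<and> T = Y - Z)}" for s
  define F2 where "F2 t = {(S, T). T \<subseteq> ?V \<and> ends M \<inter> T = {} \<and> card T = t \<and>
    (\<exists>Z. Z \<subseteq> M \<and> card Z = t \<and> S = M - Z)}" for t
  define F3 where "F3 = {(S, T). S \<subseteq> ?V \<times> ?V \<and> matching S \<and> T \<subseteq> ?V \<and> ends S \<inter> T = {} \<and> card S = k \<and> card T = k}"
  have finS: "finite (?SS s)" "finite (?TT A s)" if "finite A" for s and A :: "'b set"
    using that by auto
  have cS: "real (card (?SS s)) \<le> real n ^ (2 * s)" for s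
    using card_subsets_le_power[of "?V \<times> ?V" s]
    by (simp add: card_cartesian_product power_mult power2_eq_square flip: of_nat_mult of_nat_power)
  have cT: "real (card (?TT A s)) \<le> real n ^ s" if "finite A" "card A \<le> n" for A :: "'b set" and s
  proof -
    have "card (?TT A s) \<le> n ^ s"
      using card_subsets_le_power[OF that(1), of s] power_mono[OF that(2), of s] by linarith
    then show ?thesis by (simp flip: of_nat_power)
  qed
  have cF: "finite F \<and> real (card F) \<le> real n ^ (3 * s)"
    if "F \<subseteq> h ` (A \<times> B)" "finite A" "finite B" "real (card A) \<le> real n ^ (2 * s)" "real (card B) \<le> real n ^ s"
    for F :: "'b set" and h :: "'c \<times> 'd \<Rightarrow> 'b" and A B s
  proof
    show "finite F" using that by (auto intro: finite_subset)
    have "card F \<le> card A * card B"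
      using card_mono[OF _ that(1)] card_image_le[of "A \<times> B" h] that(2,3) by (simp add: card_cartesian_product)
    then have "real (card F) \<le> real (card A) * real (card B)" by (simp flip: of_nat_mult)
    also have "\<dots> \<le> real n ^ (2 * s) * real n ^ s" by (intro mult_mono that) auto
    finally show "real (card F) \<le> real n ^ (3 * s)" by (simp flip: power_add)
  qed
  have P1: "measure_pmf.prob ?D {g. \<exists>(S, T)\<in>F1 s. no_cherry g S T} \<le> ?x" if s: "s \<in> {1..k}" for s
  proof (rule prob_no_cherry_family[OF q])
    have "F1 s \<subseteq> (\<lambda>(S, Z). (S, Y - Z)) ` (?SS s \<times> ?TT Y s)" by (auto simp: F1_def)
    note * = cF[OF this finS(1)[OF finM(2)] finS(2)[OF finM(2)] cS cT[OF finM(2)]]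
    show "finite (F1 s)" "real (card (F1 s)) \<le> real n ^ (3 * s)" using * Y mn by auto
    fix S T assume "(S, T) \<in> F1 s"
    then obtain Z where Z: "S \<subseteq> ?V \<times> ?V" "matching S" "ends S \<inter> Y = {}" "card S = s" "Z \<subseteq> Y" "card Z = s" "T = Y - Z"
      by (auto simp: F1_def)
    have "card T = m - s" using Z finM Y by (simp add: card_Diff_subset finite_subset)
    then have "real m / 3 \<le> real (card T)" using k(4) s by auto
    then have "real s * (real m / 3) \<le> real s * real (card T)" by (rule mult_left_mono) simp
    then show "S \<subseteq> ?V \<times> ?V \<and> matching S \<and> T \<subseteq> ?V \<and> ends S \<inter> T = {} \<and> real s * (real m / 3) \<le> real (card S * card T)"
      using Z Y(1) by auto
  qed (use s True in auto)
  have P2: "measure_pmf.prob ?D {g. \<exists>(S, T)\<in>F2 t. no_cherry g S T} \<le> ?x" if t: "t \<in> {1..k}" for t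
  proof (rule prob_no_cherry_family[OF q])
    \<comment> \<open>Subsets of \<open>M\<close> are chosen among only \<open>m\<close> pairs; the
      weaker count fits the common exponent.\<close>
    have nn: "real n ^ t \<le> real n ^ (2 * t)" using mn m by (intro power_increasing) auto
    have "F2 t \<subseteq> (\<lambda>(Z, T). (M - Z, T)) ` (?TT M t \<times> ?TT ?V t)" by (auto simp: F2_def)
    note * = cF[OF this finS(2)[OF finM(1)] finS(2)[of ?V] order_trans[OF cT[OF finM(1)] nn] cT[of ?V]]
    show "finite (F2 t)" "real (card (F2 t)) \<le> real n ^ (3 * t)" using * M mn by auto
    fix S T assume "(S, T) \<in> F2 t"
    then obtain Z where Z: "T \<subseteq> ?V" "ends M \<inter> T = {}" "card T = t" "Z \<subseteq> M" "card Z = t" "S = M - Z"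
      by (auto simp: F2_def)
    have "card S = m - t" using Z finM M by (simp add: card_Diff_subset finite_subset)
    then have "real m / 3 \<le> real (card S)" using k(4) t by auto
    then have "real t * (real m / 3) \<le> real t * real (card S)" by (rule mult_left_mono) simp
    moreover have "matching S" "ends S \<inter> T = {}"
      using Z M(3) by (auto simp: matching_def ends_def intro: inj_on_subset)
    ultimately show "S \<subseteq> ?V \<times> ?V \<and> matching S \<and> T \<subseteq> ?V \<and> ends S \<inter> T = {} \<and> real t * (real m / 3) \<le> real (card S * card T)"
      using Z M(1) by (auto simp: mult.commute)
  qed (use t True in auto)
  have P3: "measure_pmf.prob ?D {g. \<exists>(S, T)\<in>F3. no_cherry g S T} \<le> ?x"
  proof (rule prob_no_cherry_family[OF q])
    have "F3 \<subseteq> id ` (?SS k \<times> ?TT ?V k)" by (auto simp: F3_def)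
    note * = cF[OF this finS(1)[OF finM(2)] finS(2)[of ?V] cS cT[of ?V]]
    show "finite F3" "real (card F3) \<le> real n ^ (3 * k)" using * by auto
    fix S T assume "(S, T) \<in> F3"
    then show "S \<subseteq> ?V \<times> ?V \<and> matching S \<and> T \<subseteq> ?V \<and> ends S \<inter> T = {} \<and> real k * (real m / 3) \<le> real (card S * card T)"
      using mult_left_mono[OF k(3), of "real k"] by (auto simp: F3_def)
  qed (use k True in auto)
  let ?E = "\<lambda>F. {g. \<exists>(S, T)\<in>F. no_cherry g S T}"
  have "{g. \<not> cherry_matchable n Y M g} \<subseteq> (\<Union>s\<in>{1..k}. ?E (F1 s)) \<union> (\<Union>t\<in>{1..k}. ?E (F2 t)) \<union> ?E F3"
  proof (rule subsetI, rule ccontr)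
    fix g assume g: "g \<in> {g. \<not> cherry_matchable n Y M g}"
      "g \<notin> (\<Union>s\<in>{1..k}. ?E (F1 s)) \<union> (\<Union>t\<in>{1..k}. ?E (F2 t)) \<union> ?E F3"
    have "cherry_matchable n Y M g"
      unfolding cherry_matchable_def
    proof (intro allI impI)
      fix P R assume PR: "M \<subseteq> P" "P \<subseteq> ?V \<times> ?V" "matching P" "Y \<subseteq> R" "R \<subseteq> ?V" "ends P \<inter> R = {}" "card P = card R"
      show "\<exists>f. bij_betw f P R \<and> (\<forall>(a, b)\<in>P. g {a, f (a, b)} \<and> g {b, f (a, b)})"
      proof (rule hall_from_cherries[OF finM(1) M(2) finM(2) Y(2) k(2) finite_lessThan _ _ _ PR])
        fix S Z assume *: "S \<subseteq> ?V \<times> ?V" "matching S" "ends S \<inter> Y = {}" "Z \<subseteq> Y" "card Z = card S" "card S \<in> {1..k}"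
        then have "(S, Y - Z) \<in> F1 (card S)" by (auto simp: F1_def)
        then show "\<not> no_cherry g S (Y - Z)" using g(2) *(6) by blast
      next
        fix Z T assume *: "Z \<subseteq> M" "T \<subseteq> ?V" "ends M \<inter> T = {}" "card Z = card T" "card T \<in> {1..k}"
        then have "(M - Z, T) \<in> F2 (card T)" by (auto simp: F2_def)
        then show "\<not> no_cherry g (M - Z) T" using g(2) *(5) by blast
      next
        fix S T assume "S \<subseteq> ?V \<times> ?V" "matching S" "T \<subseteq> ?V" "ends S \<inter> T = {}" "card S = k" "card T = k"
        then have "(S, T) \<in> F3" by (auto simp: F3_def)
        then show "\<not> no_cherry g S T" using g(2) by blast
      qed
    qed
    then show False using g(1) by simp
  qed
  then have "measure_pmf.prob ?D {g. \<not> cherry_matchable n Y M g} \<le>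
      measure_pmf.prob ?D ((\<Union>s\<in>{1..k}. ?E (F1 s)) \<union> (\<Union>t\<in>{1..k}. ?E (F2 t)) \<union> ?E F3)"
    by (intro measure_pmf.finite_measure_mono) auto
  also have "\<dots> \<le> real k * ?x + real k * ?x + ?x"
    using measure_pmf_UNION_le[of "{1..k}" ?D "\<lambda>s. ?E (F1 s)", OF _ P1]
      measure_pmf_UNION_le[of "{1..k}" ?D "\<lambda>s. ?E (F2 s)", OF _ P2] P3
    by (intro order_trans[OF measure_pmf_Un_le] add_mono) auto
  also have "\<dots> = real (2 * k + 1) * ?x" by (simp add: algebra_simps)
  also have "\<dots> \<le> real n * ?x" using mn m by (intro mult_right_mono) (auto simp: k_def)
  also have "\<dots> = real n ^ 4 * exp (- (q\<^sup>2 * (real m / 3)))" by (simp add: power_Suc[symmetric] eval_nat_numeral)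
  finally show ?thesis .
qed

section \<open>Assembling cycles from intervals of a path\<close>

text \<open>
  \<open>packs E W ks P\<close>: whichever new vertices \<open>f (a, b)\<close>, one for each pair \<open>(a, b)\<close> in \<open>P\<close>, are joined to the
  ends of the pair, they can be combined with \<open>W\<close> to disjoint cycles whose lengths are listed in \<open>ks\<close>.
\<close>

definition packs :: "'a set set \<Rightarrow> 'a set \<Rightarrow> nat list \<Rightarrow> ('a \<times> 'a) set \<Rightarrow> bool" where
  "packs E W ks P \<longleftrightarrow> finite W \<and> finite P \<and> matching P \<and> ends P \<subseteq> W \<and> card W + card P = sum_list ks \<and>
     (\<forall>f. inj_on f P \<longrightarrow> f ` P \<inter> W = {} \<longrightarrow> (\<forall>(a, b)\<in>P. {a, f (a, b)} \<in> E \<and> {b, f (a, b)} \<in> E) \<longrightarrow>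
       (\<exists>yss. map length yss = ks \<and> distinct (concat yss) \<and> set (concat yss) = W \<union> f ` P \<and>
          (\<forall>ys\<in>set yss. cycle_edges ys \<subseteq> E)))"

lemma packsE:
  assumes "packs E W ks P" "inj_on f P" "f ` P \<inter> W = {}"
    "\<And>a b. (a, b) \<in> P \<Longrightarrow> {a, f (a, b)} \<in> E \<and> {b, f (a, b)} \<in> E"
  obtains yss where "map length yss = ks" "distinct (concat yss)" "set (concat yss) = W \<union> f ` P"
    "\<forall>ys\<in>set yss. cycle_edges ys \<subseteq> E"
proof -
  have "\<forall>(a, b)\<in>P. {a, f (a, b)} \<in> E \<and> {b, f (a, b)} \<in> E" using assms(4) by blast
  then show ?thesis using assms(1-3) that unfolding packs_def by blast
qed

lemma packs_empty: "packs E {} [] {}"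
  by (auto simp: packs_def matching_def ends_def)

lemma matching_Un:
  assumes "matching P" "matching Q" "ends P \<inter> ends Q = {}"
  shows "matching (P \<union> Q)"
  using assms unfolding matching_def ends_def
  by (auto simp: inj_on_Un)

lemma packs_append:
  assumes 1: "packs E W1 ks1 P1" and 2: "packs E W2 ks2 P2" and dis: "W1 \<inter> W2 = {}"
  shows "packs E (W1 \<union> W2) (ks1 @ ks2) (P1 \<union> P2)"
proof -
  have fin: "finite W1" "finite W2" "finite P1" "finite P2" and e: "ends P1 \<subseteq> W1" "ends P2 \<subseteq> W2"
    using 1 2 by (auto simp: packs_def)
  have PP: "P1 \<inter> P2 = {}" using e dis by (force simp: ends_def)
  have "\<exists>yss. map length yss = ks1 @ ks2 \<and> distinct (concat yss) \<and> set (concat yss) = W1 \<union> W2 \<union> f ` (P1 \<union> P2) \<and>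
          (\<forall>ys\<in>set yss. cycle_edges ys \<subseteq> E)"
    if f: "inj_on f (P1 \<union> P2)" "f ` (P1 \<union> P2) \<inter> (W1 \<union> W2) = {}"
      "\<forall>(a, b)\<in>P1 \<union> P2. {a, f (a, b)} \<in> E \<and> {b, f (a, b)} \<in> E" for f
  proof -
    have f1: "inj_on f P1" "f ` P1 \<inter> W1 = {}" "\<And>a b. (a, b) \<in> P1 \<Longrightarrow> {a, f (a, b)} \<in> E \<and> {b, f (a, b)} \<in> E"
      and f2: "inj_on f P2" "f ` P2 \<inter> W2 = {}" "\<And>a b. (a, b) \<in> P2 \<Longrightarrow> {a, f (a, b)} \<in> E \<and> {b, f (a, b)} \<in> E"
      using f by (auto simp: inj_on_Un)
    obtain y1 where
      y1: "map length y1 = ks1" "distinct (concat y1)" "set (concat y1) = W1 \<union> f ` P1" "\<forall>ys\<in>set y1. cycle_edges ys \<subseteq> E"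
      using packsE[OF 1 f1] by blast
    obtain y2 where
      y2: "map length y2 = ks2" "distinct (concat y2)" "set (concat y2) = W2 \<union> f ` P2" "\<forall>ys\<in>set y2. cycle_edges ys \<subseteq> E"
      using packsE[OF 2 f2] by blast
    have "f ` P1 \<inter> f ` P2 = {}"
      using inj_on_image_Int[OF f(1), of P1 P2] PP by simp
    then have "(W1 \<union> f ` P1) \<inter> (W2 \<union> f ` P2) = {}" using dis f(2) by auto
    then have "distinct (concat (y1 @ y2))" using y1(2,3) y2(2,3) by simp
    moreover have "set (concat (y1 @ y2)) = W1 \<union> W2 \<union> f ` (P1 \<union> P2)" using y1(3) y2(3) by auto
    ultimately show ?thesis
      using y1(1,4) y2(1,4) by (intro exI[of _ "y1 @ y2"]) auto
  qed
  moreover have "matching (P1 \<union> P2)" using 1 2 e dis by (intro matching_Un) (auto simp: packs_def)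
  moreover have "card (W1 \<union> W2) + card (P1 \<union> P2) = sum_list (ks1 @ ks2)"
    using 1 2 fin PP dis by (simp add: card_Un_disjoint packs_def)
  moreover have "ends (P1 \<union> P2) \<subseteq> W1 \<union> W2" using e by (auto simp: ends_def)
  ultimately show ?thesis using fin unfolding packs_def by simp
qed

text \<open>At most two vertices form a path without closing edge, so no new vertex is spent on
  them.\<close>

lemma packs_path:
  assumes "distinct xs" "path_edges xs \<subseteq> E" "length xs \<le> 2"
  shows "packs E (set xs) [length xs] {}"
  using assms unfolding packs_def
  by (auto simp: matching_def ends_def distinct_card cycle_edges_def intro!: exI[of _ "[xs]"])

text \<open>Only the gaps between consecutive pieces are listed; the gap from the last piece back to
  the first is added separately when the cycle is closed.\<close>

fun joins :: "'a list list \<Rightarrow> ('a \<times> 'a) list" where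
  "joins (p # p' # ps) = (last p, hd p') # joins (p' # ps)"
| "joins _ = []"

fun thread :: "('a \<times> 'a \<Rightarrow> 'a) \<Rightarrow> 'a list list \<Rightarrow> 'a list" where
  "thread f (p # p' # ps) = p @ f (last p, hd p') # thread f (p' # ps)"
| "thread f [p] = p"
| "thread f [] = []"

lemma map_fst_joins: "map fst (joins ps) = map last (butlast ps)"
  by (induction ps rule: joins.induct) auto

lemma map_snd_joins: "map snd (joins ps) = map hd (tl ps)"
  by (induction ps rule: joins.induct) auto

lemma hd_thread: "ps \<noteq> [] \<Longrightarrow> [] \<notin> set ps \<Longrightarrow> hd (thread f ps) = hd (hd ps)"
  by (induction f ps rule: thread.induct) auto

lemma thread_eq_Nil: "[] \<notin> set ps \<Longrightarrow> thread f ps = [] \<longleftrightarrow> ps = []"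
  by (induction f ps rule: thread.induct) auto

lemma last_thread: "ps \<noteq> [] \<Longrightarrow> [] \<notin> set ps \<Longrightarrow> last (thread f ps) = last (last ps)"
  by (induction f ps rule: thread.induct) (auto simp: thread_eq_Nil)

lemma mset_thread: "mset (thread f ps) = mset (concat ps) + mset (map f (joins ps))"
  by (induction f ps rule: thread.induct) auto

lemma path_edges_thread:
  assumes "[] \<notin> set ps" "\<forall>p\<in>set ps. path_edges p \<subseteq> E"
    "\<forall>(a, b)\<in>set (joins ps). {a, f (a, b)} \<in> E \<and> {b, f (a, b)} \<in> E"
  shows "path_edges (thread f ps) \<subseteq> E"
  using assms
proof (induction f ps rule: thread.induct)
  case (1 f p p' ps)
  then have "path_edges (thread f (p' # ps)) \<subseteq> E" by simp
  moreover have "hd (thread f (p' # ps)) = hd p'" "thread f (p' # ps) \<noteq> []"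
    using 1 by (auto simp: hd_thread thread_eq_Nil)
  ultimately show ?case using 1 by (auto simp: path_edges_append path_edges_Cons insert_commute)
qed auto

lemma hd_last_in_concat: "p \<in> set ps \<Longrightarrow> p \<noteq> [] \<Longrightarrow> hd p \<in> set (concat ps) \<and> last p \<in> set (concat ps)"
  unfolding set_concat using hd_in_set[of p] last_in_set[of p] by blast

text \<open>Pieces of length at least two keep the pairs to be joined disjoint.\<close>

lemma packs_pieces:
  assumes ne: "ps \<noteq> []" and d: "distinct (concat ps)" and l: "\<And>p. p \<in> set ps \<Longrightarrow> 2 \<le> length p"
    and E: "\<And>p. p \<in> set ps \<Longrightarrow> path_edges p \<subseteq> E"
  shows "packs E (set (concat ps)) [length (concat ps) + length ps]
    (set ((last (last ps), hd (hd ps)) # joins ps))"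
proof -
  let ?c = "(last (last ps), hd (hd ps))"
  let ?P = "?c # joins ps"
  have nn: "[] \<notin> set ps" using l by fastforce
  have ends_disj: "distinct (map last ps @ map hd ps)" using d l
  proof (induction ps)
    case (Cons p ps)
    have p: "p \<noteq> []" "last p \<noteq> hd p" using Cons.prems(1) Cons.prems(2)[of p]
      by (auto, cases p, auto split: if_splits)
    have in_ps: "hd q \<in> set (concat ps)" "last q \<in> set (concat ps)" if "q \<in> set ps" for q
    proof -
      have "q \<noteq> []" using that Cons.prems(2)[of q] by auto
      then show "hd q \<in> set (concat ps)" "last q \<in> set (concat ps)"
        using hd_last_in_concat[OF that] by blast+
    qed
    have dis: "set p \<inter> set (concat ps) = {}" using Cons.prems(1) by auto
    have "y \<notin> last ` set ps \<union> hd ` set ps" if "y \<in> set p" for y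
    proof
      assume "y \<in> last ` set ps \<union> hd ` set ps"
      then obtain q where "q \<in> set ps" "y = last q \<or> y = hd q" by blast
      then have "y \<in> set (concat ps)" using in_ps[of q] by metis
      then show False using dis \<open>y \<in> set p\<close> by blast
    qed
    then have "hd p \<notin> last ` set ps \<union> hd ` set ps" "last p \<notin> last ` set ps \<union> hd ` set ps"
      using hd_in_set[OF p(1)] last_in_set[OF p(1)] by metis+
    moreover have "distinct (map last ps @ map hd ps)" using Cons by auto
    ultimately show ?case using p(2) by simp
  qed simp
  \<comment> \<open>With the closing gap included, the first components run once through the last
    vertices of all pieces, in rotated order; hence multisets.\<close>
  have mf: "mset (map fst ?P) = mset (map last ps)"
    using ne by (induction ps rule: rev_induct) (auto simp: map_fst_joins)
  have ms: "mset (map snd ?P) = mset (map hd ps)"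
    using ne by (cases ps) (auto simp: map_snd_joins)
  have df: "distinct (map fst ?P)" "distinct (map snd ?P)"
    using ends_disj mset_eq_imp_distinct_iff[OF mf] mset_eq_imp_distinct_iff[OF ms] by auto
  have sf: "fst ` set ?P = last ` set ps" "snd ` set ?P = hd ` set ps"
    using mset_eq_setD[OF mf] mset_eq_setD[OF ms] by simp_all
  have "matching (set ?P)"
    using df sf ends_disj unfolding matching_def distinct_map by (simp only: distinct_append distinct_map) auto
  moreover have "ends (set ?P) \<subseteq> set (concat ps)"
  proof -
    have "last p \<in> set (concat ps)" "hd p \<in> set (concat ps)" if "p \<in> set ps" for p
      using hd_last_in_concat[of p ps] that nn by blast+
    then show ?thesis unfolding ends_def sf by blast
  qed
  moreover have dP: "distinct ?P" using df by (simp only: distinct_map)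
  moreover have "length ?P = length ps" using mf by (metis length_map size_mset)
  ultimately have basic: "finite (set ?P)" "matching (set ?P)" "ends (set ?P) \<subseteq> set (concat ps)"
    "card (set (concat ps)) + card (set ?P) = sum_list [length (concat ps) + length ps]"
    using distinct_card[OF d] distinct_card[OF dP] by auto
  have "\<exists>yss. map length yss = [length (concat ps) + length ps] \<and> distinct (concat yss) \<and>
      set (concat yss) = set (concat ps) \<union> f ` set ?P \<and> (\<forall>ys\<in>set yss. cycle_edges ys \<subseteq> E)"
    if f: "inj_on f (set ?P)" "f ` set ?P \<inter> set (concat ps) = {}"
      "\<forall>(a, b)\<in>set ?P. {a, f (a, b)} \<in> E \<and> {b, f (a, b)} \<in> E" for f
  proof -
    \<comment> \<open>The vertex assigned to the closing gap comes last, so the closing edge of the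
      cycle is its edge to the first piece.\<close>
    define ys where "ys = thread f ps @ [f ?c]"
    have m: "mset ys = mset (concat ps) + mset (map f ?P)" by (simp add: ys_def mset_thread)
    then have m': "mset ys = mset (concat ps @ map f ?P)" by simp
    have "distinct (concat ps @ map f ?P)" using d f dP by (simp only: distinct_append distinct_map set_map) auto
    then have "distinct ys" using mset_eq_imp_distinct_iff[OF m'] by blast
    moreover have "set ys = set (concat ps) \<union> f ` set ?P" using mset_eq_setD[OF m'] by simp
    moreover have "length ys = length (concat ps) + length ps"
      using \<open>length ?P = length ps\<close> mset_eq_length[OF m'] by simp
    moreover have "cycle_edges ys \<subseteq> E"
    proof -
      have "path_edges (thread f ps) \<subseteq> E" using nn E f by (intro path_edges_thread) auto
      then show ?thesis using f(3) ne nn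
        by (auto simp: ys_def cycle_edges_def path_edges_append last_thread hd_thread thread_eq_Nil hd_append insert_commute)
    qed
    ultimately show ?thesis by (intro exI[of _ "[ys]"]) simp
  qed
  then show ?thesis using basic unfolding packs_def by simp
qed

lemma packs_interval:
  assumes "distinct xs" "path_edges xs \<subseteq> E" "2 \<le> length xs"
  shows "packs E (set xs) [length xs + 1] {(last xs, hd xs)}"
  using packs_pieces[of "[xs]" E] assms by simp

text \<open>Serves a cycle length \<open>l + 1\<close> occurring often: each such cycle consists of
  one block of the path and one new vertex.\<close>

lemma packs_blocks:
  assumes "distinct (concat bl)" "\<And>b. b \<in> set bl \<Longrightarrow> length b = l \<and> path_edges b \<subseteq> E" "2 \<le> l"
  shows "packs E (set (concat bl)) (replicate (length bl) (l + 1)) ((\<lambda>b. (last b, hd b)) ` set bl)"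
  using assms
proof (induction bl)
  case Nil
  then show ?case by (simp add: packs_empty)
next
  case (Cons b bl)
  have "packs E (set b) [l + 1] {(last b, hd b)}"
    using packs_interval[of b E] Cons.prems by auto
  from packs_append[OF this Cons.IH] show ?case using Cons.prems by auto
qed

lemma joins_append:
  "joins (ps @ qs) = joins ps @ (if ps = [] \<or> qs = [] then [] else [(last (last ps), hd (hd qs))]) @ joins qs"
  by (induction ps rule: joins.induct) (simp_all, cases qs, simp_all)

text \<open>Each block of four is cut in the middle, which makes its middle pair a gap. It
  contributes six vertices to the cycle: its own four, one in the middle gap and one in the gap
  after it. The final piece \<open>xs\<close> adjusts the length, and one more vertex closes the
  cycle.\<close>

lemma packs_gadget:
  assumes d: "distinct (concat bl @ xs)" and bl: "\<And>b. b \<in> set bl \<Longrightarrow> length b = 4 \<and> path_edges b \<subseteq> E"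
    and xs: "path_edges xs \<subseteq> E" "2 \<le> length xs"
  shows "\<exists>P. packs E (set (concat bl) \<union> set xs) [6 * length bl + length xs + 1] P \<and>
    (\<lambda>b. (b ! 1, b ! 2)) ` set bl \<subseteq> P"
proof -
  define ps where "ps = concat (map (\<lambda>b. [take 2 b, drop 2 b]) bl)"
  have c: "concat ps = concat bl" unfolding ps_def by (induction bl) auto
  have len: "length ps = 2 * length bl" unfolding ps_def by (induction bl) auto
  have lc: "length (concat bl) = 4 * length bl" using bl by (induction bl) auto
  have pp: "2 \<le> length p \<and> path_edges p \<subseteq> E" if "p \<in> set ps" for p
  proof -
    obtain b where b: "b \<in> set bl" "p = take 2 b \<or> p = drop 2 b" using \<open>p \<in> set ps\<close> by (auto simp: ps_def)
    then show ?thesis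
      using bl[OF b(1)] path_edges_take[of 2 b] path_edges_drop[of 2 b] by auto
  qed
  have "packs E (set (concat (ps @ [xs]))) [length (concat (ps @ [xs])) + length (ps @ [xs])]
    (set ((last (last (ps @ [xs])), hd (hd (ps @ [xs]))) # joins (ps @ [xs])))"
    by (rule packs_pieces) (use d c pp xs in auto)
  then have "packs E (set (concat bl) \<union> set xs) [6 * length bl + length xs + 1]
    (set ((last xs, hd (hd (ps @ [xs]))) # joins (ps @ [xs])))"
    using c len lc by (simp add: algebra_simps)
  moreover have "(b ! 1, b ! 2) \<in> set (joins ps)" if "b \<in> set bl" for b
  proof -
    obtain as bs where sp: "bl = as @ b # bs" using \<open>b \<in> set bl\<close> split_list by metis
    obtain w x y z where b: "b = [w, x, y, z]" using bl[OF \<open>b \<in> set bl\<close>] by (auto simp: length_Suc_conv numeral_eq_Suc)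
    have "ps = concat (map (\<lambda>b. [take 2 b, drop 2 b]) as) @ [[w, x], [y, z]] @ concat (map (\<lambda>b. [take 2 b, drop 2 b]) bs)"
      by (simp add: ps_def sp b)
    then show ?thesis using b by (simp add: joins_append)
  qed
  moreover have "set (joins ps) \<subseteq> set (joins (ps @ [xs]))" by (auto simp: joins_append)
  ultimately show ?thesis by (intro exI[of _ "set ((last xs, hd (hd (ps @ [xs]))) # joins (ps @ [xs]))"]) auto
qed

text \<open>Greedy distribution: a cycle of length \<open>k\<close> takes as many of the remaining
  blocks as fit. The 3 in \<open>(k - 3) div 6\<close> reserves two vertices for its interval of
  \<open>xs\<close> and one for closing the cycle.\<close>

lemma packs_gadgets:
  assumes "distinct (concat bl @ xs)" "\<And>b. b \<in> set bl \<Longrightarrow> length b = 4 \<and> path_edges b \<subseteq> E"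
    "path_edges xs \<subseteq> E" "\<And>k. k \<in> set ks \<Longrightarrow> 3 \<le> k"
    "length bl \<le> (\<Sum>k\<leftarrow>ks. (k - 3) div 6)" "length xs + 6 * length bl + length ks = sum_list ks"
  shows "\<exists>P. packs E (set (concat bl) \<union> set xs) ks P \<and> (\<lambda>b. (b ! 1, b ! 2)) ` set bl \<subseteq> P"
  using assms
proof (induction ks arbitrary: bl xs)
  case Nil
  then show ?case by (intro exI[of _ "{}"]) (simp add: packs_empty)
next
  case (Cons k ks)
  define q where "q = min (length bl) ((k - 3) div 6)"
  define r where "r = k - 6 * q - 1"
  have k3: "3 \<le> k" using Cons.prems(4) by simp
  have "6 * q \<le> k - 3" unfolding q_def
    by (metis div_times_less_eq_dividend min.cobounded2 mult.commute mult_le_mono2 order_trans)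
  then have r: "2 \<le> r" "6 * q + r + 1 = k" using k3 by (auto simp: r_def)
  have "\<forall>k\<in>set ks. 3 \<le> k" using Cons.prems(4) by simp
  \<comment> \<open>The later cycles can absorb all remaining blocks, so by the vertex count
    \<open>xs\<close> still has the \<open>r\<close> vertices needed for the current cycle.\<close>
  then have capsum: "6 * (\<Sum>k\<leftarrow>ks. (k - 3) div 6) + 3 * length ks \<le> sum_list ks"
    by (induction ks) auto
  define b1 b2 x1 x2 where "b1 = take q bl" and "b2 = drop q bl" and "x1 = take r xs" and "x2 = drop r xs"
  have q: "q \<le> length bl" by (simp add: q_def)
  have rest: "length b2 \<le> (\<Sum>k\<leftarrow>ks. (k - 3) div 6)"
    using Cons.prems(5) by (auto simp: b2_def q_def min_def)
  have "length xs + 6 * length b2 + length ks = r + sum_list ks"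
    using Cons.prems(6) r(2) q by (simp add: b2_def)
  then have "r \<le> length xs" using rest capsum by linarith
  then have lx: "length x1 = r" "length x2 + 6 * length b2 + length ks = sum_list ks"
    using \<open>length xs + 6 * length b2 + length ks = r + sum_list ks\<close> by (auto simp: x1_def x2_def)
  have sp: "bl = b1 @ b2" "xs = x1 @ x2" by (simp_all add: b1_def b2_def x1_def x2_def)
  have lb: "length b1 = q" using q by (simp add: b1_def)
  have pe: "path_edges x1 \<subseteq> E" "path_edges x2 \<subseteq> E"
    using Cons.prems(3) path_edges_take[of r xs] path_edges_drop[of r xs] by (auto simp: x1_def x2_def)
  have "\<exists>P. packs E (set (concat b1) \<union> set x1) [6 * length b1 + length x1 + 1] P \<and> (\<lambda>b. (b ! 1, b ! 2)) ` set b1 \<subseteq> P"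
    by (rule packs_gadget) (use Cons.prems(1,2) pe lx r sp in auto)
  then obtain P1 where P1: "packs E (set (concat b1) \<union> set x1) [k] P1" "(\<lambda>b. (b ! 1, b ! 2)) ` set b1 \<subseteq> P1"
    using lb lx(1) r(2) by auto
  have "\<exists>P. packs E (set (concat b2) \<union> set x2) ks P \<and> (\<lambda>b. (b ! 1, b ! 2)) ` set b2 \<subseteq> P"
    by (rule Cons.IH) (use Cons.prems(1,2,4) pe lx rest sp in auto)
  then obtain P2 where P2: "packs E (set (concat b2) \<union> set x2) ks P2" "(\<lambda>b. (b ! 1, b ! 2)) ` set b2 \<subseteq> P2"
    by blast
  have "(set (concat b1) \<union> set x1) \<inter> (set (concat b2) \<union> set x2) = {}"
    using Cons.prems(1) unfolding sp by (simp only: concat_append distinct_append set_append) blast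
  from packs_append[OF P1(1) P2(1) this] show ?case
    using P1(2) P2(2) by (intro exI[of _ "P1 \<union> P2"]) (auto simp: sp Un_ac)
qed

section \<open>Embedding by comparing cycle lengths\<close>

lemma permute_to_map:
  "mset (map f xs) = mset ys \<Longrightarrow> \<exists>xs'. mset xs' = mset xs \<and> map f xs' = ys"
proof (induction ys arbitrary: xs)
  case (Cons y ys)
  then have "y \<in> f ` set xs" by (metis list.set_intros(1) list.set_map mset_eq_setD)
  then obtain x where x: "x \<in> set xs" "f x = y" by blast
  have "mset (map f (remove1 x xs)) = mset ys"
    using Cons.prems x by (simp add: image_mset_Diff)
  then obtain xs' where "mset xs' = mset (remove1 x xs)" "map f xs' = ys" using Cons.IH by blast
  then show ?case using x by (intro exI[of _ "x # xs'"]) auto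
qed simp

text \<open>Reorder the first cover so that its lengths agree with those of the second in order,
  then map the concatenated lists position by position; each cycle goes to its counterpart.\<close>

lemma contains_copy_of_cycles:
  assumes x: "distinct (concat xss)" "set (concat xss) = {..<n}" "\<And>e. e \<in> F \<Longrightarrow> \<exists>xs\<in>set xss. e \<in> cycle_edges xs"
    and y: "distinct (concat yss)" "set (concat yss) = {..<n}" "\<And>ys. ys \<in> set yss \<Longrightarrow> cycle_edges ys \<subseteq> G"
    and len: "mset (map length xss) = mset (map length yss)"
  shows "contains_copy n G F"
proof -
  obtain xss' where xss': "mset xss' = mset xss" "map length xss' = map length yss"
    using permute_to_map[OF len] by blast
  define X Y where "X = concat xss'" and "Y = concat yss"
  define \<phi> where "\<phi> v = the (map_of (zip X Y) v)" for v
  have mX: "mset X = mset (concat xss)" unfolding X_def using xss'(1)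
    by (metis mset_concat mset_map sum_mset_sum_list)
  have X: "distinct X" "set X = {..<n}" "length X = length Y"
    using mset_eq_imp_distinct_iff[OF mX] mset_eq_setD[OF mX] x xss'(2) by (auto simp: X_def Y_def length_concat)
  have mapX: "map \<phi> X = Y"
    by (rule nth_equalityI) (use X in \<open>auto simp: \<phi>_def map_of_zip_nth\<close>)
  have "concat (map (map \<phi>) xss') = concat yss" using mapX by (simp add: X_def Y_def map_concat)
  moreover have "\<forall>(x, y)\<in>set (zip (map (map \<phi>) xss') yss). length x = length y"
    using xss'(2) by (auto simp: set_zip) (metis length_map nth_map)
  moreover have "length (map (map \<phi>) xss') = length yss" using xss'(2) by (metis length_map)
  \<comment> \<open>Equal concatenations with equal lengths of the parts have equal parts.\<close>
  ultimately have yss: "map (map \<phi>) xss' = yss" using concat_injective by blast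
  have "inj_on \<phi> {..<n}" using mapX y(1) X(2) by (metis Y_def distinct_map)
  moreover have "\<phi> ` {..<n} \<subseteq> {..<n}" using mapX y(2) X(2) by (metis Y_def order_refl set_map)
  moreover have "\<phi> ` e \<in> G" if e: "e \<in> F" for e
  proof -
    obtain xs where xs: "xs \<in> set xss'" "e \<in> cycle_edges xs" using x(3)[OF e] mset_eq_setD[OF xss'(1)] by blast
    then have "map \<phi> xs \<in> set yss" using yss by auto
    from y(3)[OF this] show ?thesis using xs(2) by (auto simp: cycle_edges_map)
  qed
  ultimately show ?thesis unfolding contains_copy_def by blast
qed

section \<open>Blocks of the path and the choice of a template\<close>

fun chunks :: "nat \<Rightarrow> nat \<Rightarrow> 'a list \<Rightarrow> 'a list list" where
  "chunks l 0 xs = []"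
| "chunks l (Suc m) xs = take l xs # chunks l m (drop l xs)"

lemma length_chunks [simp]: "length (chunks l m xs) = m"
  by (induction m arbitrary: xs) auto

lemma concat_chunks: "concat (chunks l m xs) = take (l * m) xs"
  by (induction m arbitrary: xs) (auto simp: take_add)

lemma chunks_props:
  "l * m \<le> length xs \<Longrightarrow> b \<in> set (chunks l m xs) \<Longrightarrow> length b = l \<and> path_edges b \<subseteq> path_edges xs"
proof (induction m arbitrary: xs)
  case (Suc m)
  show ?case
  proof (cases "b = take l xs")
    case True then show ?thesis using Suc.prems path_edges_take[of l xs] by auto
  next
    case False
    then have "length b = l \<and> path_edges b \<subseteq> path_edges (drop l xs)"
      by (intro Suc.IH) (use Suc.prems in auto)
    then show ?thesis using path_edges_drop[of l xs] by blast
  qed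
qed simp

lemma matching_of_blocks:
  assumes "distinct (concat bl)" "\<And>b. b \<in> set bl \<Longrightarrow> u b \<in> set b \<and> v b \<in> set b \<and> u b \<noteq> v b"
  shows "matching ((\<lambda>b. (u b, v b)) ` set bl) \<and> card ((\<lambda>b. (u b, v b)) ` set bl) = length bl"
proof -
  have eq: "b = b'" if "b \<in> set bl" "b' \<in> set bl" "x \<in> set b" "x \<in> set b'" for b b' x
    using assms(1) that
  proof (induction bl)
    case (Cons c bl) then show ?case by auto
  qed simp
  have ne: "[] \<notin> set bl" using assms(2)[of "[]"] by auto
  have "inj_on u (set bl)" "inj_on v (set bl)" "\<forall>b\<in>set bl. \<forall>b'\<in>set bl. u b \<noteq> v b'"
    using eq assms(2) by (metis inj_onI)+
  moreover have "distinct bl" using assms(1) ne by (simp add: distinct_concat_iff removeAll_id)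
  ultimately show ?thesis
    unfolding matching_def
    by (auto simp: inj_on_def card_image distinct_card)
qed

text \<open>
  The pairs whose presence in the matching problem is known before the graph to be embedded:
  the two neighbours of the matched vertex in the first cycles of length \<open>l + 1\<close>, or the middle
  pairs of the four-vertex blocks used for long cycles.
\<close>

definition templates :: "nat \<Rightarrow> 'a list \<Rightarrow> ('a \<times> 'a) set set" where
  "templates m hs = insert ((\<lambda>b. (b ! 1, b ! 2)) ` set (chunks 4 m (take (4 * m) hs)))
     ((\<lambda>l. (\<lambda>b. (last b, hd b)) ` set (chunks l m (take (l * m) hs))) ` {2..7})"

lemma templates_props:
  assumes hs: "distinct hs" "7 * m \<le> length hs" and M: "M \<in> templates m hs"
  shows "M \<subseteq> set hs \<times> set hs" "matching M" "card M = m"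
proof -
  have *: "matching ((\<lambda>b. (u b, v b)) ` set (chunks l m (take (l * m) hs))) \<and>
      card ((\<lambda>b. (u b, v b)) ` set (chunks l m (take (l * m) hs))) = m \<and>
      (\<lambda>b. (u b, v b)) ` set (chunks l m (take (l * m) hs)) \<subseteq> set hs \<times> set hs"
    if l: "l \<le> 7" and uv: "\<And>b. length b = l \<Longrightarrow> distinct b \<Longrightarrow> u b \<in> set b \<and> v b \<in> set b \<and> u b \<noteq> v b" for l u v
  proof -
    let ?bl = "chunks l m (take (l * m) hs)"
    have lm: "l * m \<le> length hs" using hs(2) mult_le_mono1[OF l, of m] by linarith
    have c: "concat ?bl = take (l * m) hs" by (simp add: concat_chunks)
    have d: "distinct (concat ?bl)" using c hs(1) by simp
    have b: "u b \<in> set b \<and> v b \<in> set b \<and> u b \<noteq> v b" if "b \<in> set ?bl" for b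
    proof (rule uv)
      show "length b = l" using chunks_props[OF _ that] lm by simp
      show "distinct b" using d that by (simp add: distinct_concat_iff)
    qed
    have "set b \<subseteq> set hs" if "b \<in> set ?bl" for b
    proof -
      have "set b \<subseteq> set (concat ?bl)" using that by auto
      then show ?thesis using c set_take_subset[of "l * m" hs] by auto
    qed
    then show ?thesis using matching_of_blocks[OF d b] b by fastforce
  qed
  have "M \<subseteq> set hs \<times> set hs \<and> matching M \<and> card M = m"
    using M unfolding templates_def
  proof (elim insertE imageE)
    assume M: "M = (\<lambda>b. (b ! 1, b ! 2)) ` set (chunks 4 m (take (4 * m) hs))"
    show ?thesis unfolding M using *[of 4 "\<lambda>b. b ! 1" "\<lambda>b. b ! 2"] by (simp add: nth_eq_iff_index_eq)
  next
    fix l :: nat assume l: "l \<in> {2..7}" and M: "M = (\<lambda>b. (last b, hd b)) ` set (chunks l m (take (l * m) hs))"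
    have "last b \<in> set b \<and> hd b \<in> set b \<and> last b \<noteq> hd b" if "length b = l" "distinct b" for b :: "'a list"
    proof -
      have "b \<noteq> []" "length b \<ge> 2" using that l by auto
      then show ?thesis using that(2)
        by (cases b) auto
    qed
    then show ?thesis unfolding M using *[of l last hd] l by simp
  qed
  then show "M \<subseteq> set hs \<times> set hs" "matching M" "card M = m" by auto
qed

text \<open>Charge each cycle of length 3 to 8 to its length and each longer one to the number of
  blocks it can hold. If every total were below \<open>m\<close>, the cycles would be too small to
  cover the graph.\<close>

lemma popular_or_long:
  fixes ks :: "nat list"
  assumes ks: "\<And>k. k \<in> set ks \<Longrightarrow> 3 \<le> k" and sum: "60 * m \<le> sum_list ks + 2" and m: "1 \<le> m"
  obtains l where "l \<in> {2..7}" "m \<le> count_list ks (l + 1)" | "m \<le> (\<Sum>k\<leftarrow>ks. (k - 3) div 6)"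
proof -
  have "sum_list ks \<le> 3 * count_list ks 3 + 4 * count_list ks 4 + 5 * count_list ks 5 + 6 * count_list ks 6
    + 7 * count_list ks 7 + 8 * count_list ks 8 + 14 * (\<Sum>k\<leftarrow>ks. (k - 3) div 6)"
    using ks
  proof (induction ks)
    case (Cons k ks)
    have IH: "sum_list ks \<le> 3 * count_list ks 3 + 4 * count_list ks 4 + 5 * count_list ks 5 + 6 * count_list ks 6
      + 7 * count_list ks 7 + 8 * count_list ks 8 + 14 * (\<Sum>k\<leftarrow>ks. (k - 3) div 6)"
      using Cons by simp
    consider "k \<in> {3, 4, 5, 6, 7, 8}" | "9 \<le> k" using Cons.prems[of k] by fastforce
    then show ?case
    proof cases
      case 2
      then have "1 \<le> (k - 3) div 6" by (simp add: div_greater_zero_iff Suc_leI)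
      \<comment> \<open>If the quotient is \<open>j\<close>, then \<open>k \<le> 6 * j + 8\<close>,
        and \<open>j\<close> is at least 1.\<close>
      then have "k \<le> 14 * ((k - 3) div 6)" by linarith
      then show ?thesis using IH 2 by simp
    qed (use IH in auto)
  qed simp
  \<comment> \<open>The coefficients 3 to 8 and 14 add up to 47, which is less than 60.\<close>
  then have "\<not> (count_list ks 3 < m \<and> count_list ks 4 < m \<and> count_list ks 5 < m \<and> count_list ks 6 < m \<and>
    count_list ks 7 < m \<and> count_list ks 8 < m \<and> (\<Sum>k\<leftarrow>ks. (k - 3) div 6) < m)"
    using sum m by linarith
  then have "m \<le> count_list ks 3 \<or> m \<le> count_list ks 4 \<or> m \<le> count_list ks 5 \<or> m \<le> count_list ks 6 \<or>
    m \<le> count_list ks 7 \<or> m \<le> count_list ks 8 \<or> m \<le> (\<Sum>k\<leftarrow>ks. (k - 3) div 6)"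
    by (simp add: not_less)
  then consider "m \<le> count_list ks 3" | "m \<le> count_list ks 4" | "m \<le> count_list ks 5"
    | "m \<le> count_list ks 6" | "m \<le> count_list ks 7" | "m \<le> count_list ks 8" | "m \<le> (\<Sum>k\<leftarrow>ks. (k - 3) div 6)"
    by (elim disjE)
  then show ?thesis
    using that(1)[of 2] that(1)[of 3] that(1)[of 4] that(1)[of 5] that(1)[of 6] that(1)[of 7] that(2)
    by cases simp_all
qed

lemma split_list_lengths:
  assumes "a + b + c \<le> length xs"
  obtains A B C D where "xs = A @ B @ C @ D" "length A = a" "length B = b" "length C = c"
  by (rule that[of "take a xs" "take b (drop a xs)" "take c (drop (a + b) xs)" "drop (a + b + c) xs"])
     (use assms in \<open>auto simp: take_add[symmetric] append_assoc[symmetric] simp del: append_assoc\<close>)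

text \<open>The path is cut into \<open>A\<close> for the blocks of the template, \<open>B\<close>
  for the rest of the cycles, \<open>C\<close> for the short path, and a remainder \<open>D\<close>
  whose vertices stay free for the matching. It is long enough because the template alone absorbs at
  least \<open>m\<close> new vertices.\<close>

lemma packs_template:
  assumes hs: "distinct hs" "path_edges hs \<subseteq> E" "length hs = n - m"
    and ks: "\<And>k. k \<in> set ks \<Longrightarrow> 3 \<le> k" and z: "z \<le> 2" and n: "sum_list ks + z = n"
    and m: "1 \<le> m" "60 * m \<le> n"
  obtains M W P ks' where "M \<in> templates m hs" "M \<subseteq> P" "packs E W ks' P" "W \<subseteq> set hs" "mset ks' = mset (z # ks)"
proof -
  have sum: "60 * m \<le> sum_list ks + 2" using n z m by simp
  show ?thesis
  proof (cases rule: popular_or_long[OF ks sum m(1)])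
    case (2 l)
    have "replicate_mset m (l + 1) \<subseteq># mset ks"
      using 2(2) by (simp add: count_le_replicate_mset_subset_eq[symmetric] count_mset)
    then obtain ks1 where ks1: "mset ks = mset (replicate m (l + 1) @ ks1)"
      by (metis ex_mset mset_append mset_replicate subset_mset.add_diff_inverse)
    have k1: "3 \<le> k" if "k \<in> set ks1" for k using ks mset_eq_setD[OF ks1] that by auto
    have "sum_list ks = m * (l + 1) + sum_list ks1"
      using arg_cong[OF ks1, of sum_mset] by (simp add: sum_mset_sum_list sum_list_replicate)
    moreover have s1: "length ks1 \<le> sum_list ks1" using k1 by (induction ks1) force+
    ultimately have "l * m + (sum_list ks1 - length ks1) + z \<le> length hs"
      using hs(3) n by (simp add: algebra_simps)
    then obtain A B C D where sp: "hs = A @ B @ C @ D" "length A = l * m" "length B = sum_list ks1 - length ks1" "length C = z"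
      by (rule split_list_lengths)
    have pe: "path_edges A \<subseteq> E" "path_edges B \<subseteq> E" "path_edges C \<subseteq> E"
      using hs(2) unfolding sp by (auto simp: path_edges_append)
    let ?bl = "chunks l m A"
    have c: "concat ?bl = A" using sp(2) by (simp add: concat_chunks)
    have p1: "packs E (set A) (replicate m (l + 1)) ((\<lambda>b. (last b, hd b)) ` set ?bl)"
      using packs_blocks[of ?bl l E] c hs(1) sp 2(1) chunks_props[of l m A] pe(1) by fastforce
    \<comment> \<open>Without blocks, every remaining cycle is just an interval with one new
      vertex.\<close>
    have "\<exists>P. packs E (set (concat []) \<union> set B) ks1 P \<and> (\<lambda>b. (b ! 1, b ! 2)) ` set [] \<subseteq> P"
      by (rule packs_gadgets) (use hs(1) sp pe k1 s1 in auto)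
    then obtain P2 where p2: "packs E (set B) ks1 P2" by auto
    have p3: "packs E (set C) [z] {}" using packs_path[of C E] hs(1) sp pe z by auto
    have "packs E (set A \<union> set B) (replicate m (l + 1) @ ks1) ((\<lambda>b. (last b, hd b)) ` set ?bl \<union> P2)"
      by (rule packs_append[OF p1 p2]) (use hs(1) sp in auto)
    from packs_append[OF this p3]
    have pk: "packs E (set A \<union> set B \<union> set C) ((replicate m (l + 1) @ ks1) @ [z]) ((\<lambda>b. (last b, hd b)) ` set ?bl \<union> P2 \<union> {})"
      using hs(1) sp by auto
    have "(\<lambda>b. (last b, hd b)) ` set ?bl \<in> templates m hs"
      unfolding templates_def by (rule insertI2, rule image_eqI[of _ _ l]) (use 2(1) sp in auto)
    then show ?thesis by (rule that[OF _ _ pk]) (use sp ks1 in auto)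
  next
    case 3
    \<comment> \<open>This ensures that the natural-number subtraction defining the length of
      \<open>B\<close> is not truncated.\<close>
    have s6: "6 * (\<Sum>k\<leftarrow>ks. (k - 3) div 6) + length ks \<le> sum_list ks"
      using ks
    proof (induction ks)
      case (Cons k ks)
      then show ?case using Cons.prems[of k] by fastforce
    qed simp
    then have "4 * m + (sum_list ks - length ks - 6 * m) + z \<le> length hs"
      using hs(3) n 3 by simp
    then obtain A B C D where sp: "hs = A @ B @ C @ D" "length A = 4 * m" "length B = sum_list ks - length ks - 6 * m" "length C = z"
      by (rule split_list_lengths)
    have pe: "path_edges A \<subseteq> E" "path_edges B \<subseteq> E" "path_edges C \<subseteq> E"
      using hs(2) unfolding sp by (auto simp: path_edges_append)
    let ?bl = "chunks 4 m A"
    have c: "concat ?bl = A" using sp(2) by (simp add: concat_chunks)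
    have "\<exists>P. packs E (set (concat ?bl) \<union> set B) ks P \<and> (\<lambda>b. (b ! 1, b ! 2)) ` set ?bl \<subseteq> P"
    proof (rule packs_gadgets)
      show "length b = 4 \<and> path_edges b \<subseteq> E" if "b \<in> set ?bl" for b
        using chunks_props[OF _ that] sp(2) pe(1) by auto
      show "length B + 6 * length ?bl + length ks = sum_list ks" using sp(3) s6 3 by simp
    qed (use hs(1) sp pe ks 3 c in auto)
    then obtain P where P: "packs E (set A \<union> set B) ks P" "(\<lambda>b. (b ! 1, b ! 2)) ` set ?bl \<subseteq> P"
      unfolding c by blast
    have p3: "packs E (set C) [z] {}" using packs_path[of C E] hs(1) sp pe z by auto
    have "packs E (set A \<union> set B \<union> set C) (ks @ [z]) (P \<union> {})"
      by (rule packs_append[OF P(1) p3]) (use hs(1) sp in auto)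
    then show ?thesis
      by (rule that[rotated 2, where M = "(\<lambda>b. (b ! 1, b ! 2)) ` set ?bl"]) (use P(2) sp in \<open>auto simp: templates_def\<close>)
  qed
qed

text \<open>The graph to be embedded determines \<open>W\<close> and \<open>P\<close>; the vertices
  to be matched are all those outside \<open>W\<close>. They include the complement of
  \<open>hs\<close>, and \<open>P\<close> includes a template, so the matching property
  applies.\<close>

lemma universal_of_long_path:
  assumes m: "1 \<le> m" "60 * m \<le> n"
    and hs: "distinct hs" "set hs \<subseteq> {..<n}" "path_edges hs \<subseteq> G" "length hs = n - m"
    and match: "\<And>M. M \<in> templates m hs \<Longrightarrow> cherry_matchable n ({..<n} - set hs) M g"
    and g: "\<And>e. g e \<Longrightarrow> e \<in> G"
  shows "universal n (bounded_degree_graphs n 2) G"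
  unfolding universal_def
proof
  fix F assume "F \<in> bounded_degree_graphs n 2"
  then have F: "F \<subseteq> nsets {..<n} 2" "\<And>v. v \<in> {..<n} \<Longrightarrow> card {e \<in> F. v \<in> e} \<le> 2"
    by (auto simp: bounded_degree_graphs_def graphs_on_def degree_def)
  obtain z xss where x: "distinct (concat (z # xss))" "set (concat (z # xss)) = {..<n}"
    "length z \<le> 2" "\<And>xs. xs \<in> set xss \<Longrightarrow> 3 \<le> length xs"
    "\<And>e. e \<in> F \<Longrightarrow> \<exists>xs\<in>set (z # xss). e \<in> cycle_edges xs"
    using cycle_cover[OF finite_lessThan F] by blast
  have "length (concat (z # xss)) = n" using distinct_card[OF x(1)] x(2) by simp
  then have n: "sum_list (map length xss) + length z = n" by (simp add: length_concat)
  obtain M W P ks' where *: "M \<in> templates m hs" "M \<subseteq> P" "packs G W ks' P" "W \<subseteq> set hs"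
    "mset ks' = mset (length z # map length xss)"
    by (rule packs_template[OF hs(1,3,4) _ x(3) n m]) (use x(4) in auto)
  have W: "finite W" "matching P" "ends P \<subseteq> W" "card W + card P = sum_list ks'"
    using *(3) by (auto simp: packs_def)
  \<comment> \<open>The cycles and the short path have \<open>n\<close> vertices altogether, so
    there are exactly as many pairs as vertices outside \<open>W\<close>.\<close>
  have "sum_list ks' = sum_list (length z # map length xss)" using *(5) by (metis sum_mset_sum_list)
  then have "sum_list ks' = n" using n by simp
  moreover have "card ({..<n} - W) = n - card W" using W(1) *(4) hs(2) by (subst card_Diff_subset) auto
  ultimately have "card P = card ({..<n} - W)" using W(4) by simp
  moreover have "P \<subseteq> {..<n} \<times> {..<n}"
  proof
    fix p assume "p \<in> P"
    then have "fst p \<in> ends P" "snd p \<in> ends P" by (auto simp: ends_def)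
    then show "p \<in> {..<n} \<times> {..<n}" using W(3) *(4) hs(2) by (cases p) auto
  qed
  moreover have "ends P \<inter> ({..<n} - W) = {}" using W(3) by blast
  ultimately have "\<exists>f. bij_betw f P ({..<n} - W) \<and> (\<forall>(a, b)\<in>P. g {a, f (a, b)} \<and> g {b, f (a, b)})"
    using match[OF *(1)] *(2,4) W(2)
    by (intro match[OF *(1), unfolded cherry_matchable_def, rule_format, of P "{..<n} - W"]) auto
  then obtain f where f: "bij_betw f P ({..<n} - W)" "\<forall>(a, b)\<in>P. g {a, f (a, b)} \<and> g {b, f (a, b)}"
    by blast
  have f1: "inj_on f P" "f ` P = {..<n} - W" using f(1) by (auto simp: bij_betw_def)
  then have f2: "f ` P \<inter> W = {}" by auto
  obtain yss where y: "map length yss = ks'" "distinct (concat yss)" "set (concat yss) = W \<union> f ` P"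
    "\<forall>ys\<in>set yss. cycle_edges ys \<subseteq> G"
    using packsE[OF *(3) f1(1) f2] f(2) g by blast
  show "contains_copy n G F"
  proof (rule contains_copy_of_cycles[OF x(1,2,5) y(2)])
    show "set (concat yss) = {..<n}" using y(3) f1(2) *(4) hs(2) by auto
    show "mset (map length (z # xss)) = mset (map length yss)" using *(5) y(1) by simp
  qed (use y(4) in auto)
qed

section \<open>Two rounds of exposure\<close>

lemma bernoulli_pmf_two_rounds:
  assumes "0 \<le> q" "q \<le> 1"
  shows "bernoulli_pmf (1 - (1 - q)\<^sup>2) =
    bind_pmf (bernoulli_pmf q) (\<lambda>b. bind_pmf (bernoulli_pmf q) (\<lambda>c. return_pmf (b \<or> c)))"
proof (rule pmf_eqI)
  fix x
  have "0 \<le> 1 - (1 - q)\<^sup>2" "1 - (1 - q)\<^sup>2 \<le> 1" using assms by (auto simp: power_le_one)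
  then show "pmf (bernoulli_pmf (1 - (1 - q)\<^sup>2)) x =
    pmf (bind_pmf (bernoulli_pmf q) (\<lambda>b. bind_pmf (bernoulli_pmf q) (\<lambda>c. return_pmf (b \<or> c)))) x"
    using assms by (cases x) (simp_all add: pmf_bind power2_eq_square algebra_simps)
qed

lemma gnp_two_rounds:
  assumes "0 \<le> q" "q \<le> 1"
  defines "D \<equiv> \<lambda>n::nat. Pi_pmf (nsets {..<n} 2) False (\<lambda>_. bernoulli_pmf q)"
  shows "gnp n (1 - (1 - q)\<^sup>2) = map_pmf (\<lambda>(f, g). {e \<in> nsets {..<n} 2. f e \<or> g e}) (pair_pmf (D n) (D n))"
proof -
  have fin: "finite ([{..<n}]\<^bsup>2\<^esup>)" by (simp add: finite_imp_finite_nsets)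
  show ?thesis
    unfolding gnp_def bernoulli_pmf_two_rounds[OF assms(1,2)] D_def
    by (subst Pi_pmf_bind[OF fin, where d' = False], subst Pi_pmf_bind[OF fin, where d' = False])
       (simp add: fin pair_pmf_def map_pmf_def bind_assoc_pmf bind_return_pmf conj_disj_distribL cong: conj_cong)
qed

text \<open>Conditioning on the first round lets the second-round event depend on its outcome, here
  through the path that was found; outcomes that are not \<open>ok\<close> are charged probability
  1.\<close>

lemma prob_pair_pmf_le:
  assumes "\<And>x. ok x \<Longrightarrow> measure_pmf.prob N {y. bad x y} \<le> \<delta>" "0 \<le> \<delta>"
  shows "measure_pmf.prob (pair_pmf M N) {(x, y). bad x y} \<le> measure_pmf.prob M {x. \<not> ok x} + \<delta>"
proof -
  let ?X = "{(x, y). bad x y}"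
  have "emeasure (pair_pmf M N) ?X = (\<integral>\<^sup>+x. emeasure N {y. bad x y} \<partial>M)"
  proof -
    have "pair_pmf M N = bind_pmf M (\<lambda>x. map_pmf (Pair x) N)"
      by (simp add: pair_pmf_def map_pmf_def)
    then show ?thesis by (simp add: vimage_def)
  qed
  also have "\<dots> \<le> (\<integral>\<^sup>+x. indicator {x. \<not> ok x} x + ennreal \<delta> \<partial>M)"
  proof (rule nn_integral_mono)
    fix x
    show "emeasure N {y. bad x y} \<le> indicator {x. \<not> ok x} x + ennreal \<delta>"
    proof (cases "ok x")
      case True
      then show ?thesis using assms by (simp add: measure_pmf.emeasure_eq_measure ennreal_leI)
    next
      case False
      have "emeasure N {y. bad x y} \<le> 1" by (rule measure_pmf.emeasure_le_1)
      also have "\<dots> \<le> 1 + ennreal \<delta>" by simp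
      finally show ?thesis using False by simp
    qed
  qed
  also have "\<dots> = emeasure M {x. \<not> ok x} + ennreal \<delta>"
    by (subst nn_integral_add) auto
  also have "\<dots> = ennreal (measure_pmf.prob M {x. \<not> ok x} + \<delta>)"
    using assms(2) by (simp add: measure_pmf.emeasure_eq_measure ennreal_plus)
  finally show ?thesis
    using assms(2) by (simp add: measure_pmf.emeasure_eq_measure del: ennreal_plus)
qed

text \<open>The first term bounds the failure of expansion, hence of the path, in the first round.
  Once the path is fixed, the second round has to be good only for its templates.\<close>

lemma prob_not_universal:
  assumes q: "0 \<le> q" "q \<le> 1" and m: "3 \<le> m" "60 * m \<le> n"
  shows "measure_pmf.prob (gnp n (1 - (1 - q)\<^sup>2)) {G. \<not> universal n (bounded_degree_graphs n 2) G}
    \<le> 4 ^ n * exp (- (q * real (m div 2 * (m div 2)))) + 7 * (real n ^ 4 * exp (- (q\<^sup>2 * (real m / 3))))"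
proof -
  define A where "A = nsets {..<n} 2"
  define D where "D = Pi_pmf A False (\<lambda>_. bernoulli_pmf q)"
  let ?k = "m div 2" and ?V = "{..<n}"
  \<comment> \<open>Expansion at size \<open>m div 2\<close> suffices, since the path may leave
    \<open>m\<close> vertices uncovered.\<close>
  define ok where "ok f \<longleftrightarrow> \<not> (\<exists>D U. D \<subseteq> ?V \<and> U \<subseteq> ?V \<and> D \<inter> U = {} \<and> card D = ?k \<and> card U = ?k \<and>
    (\<forall>d\<in>D. \<forall>u\<in>U. \<not> f {d, u}))" for f :: "nat set \<Rightarrow> bool"
  define bad where "bad f g \<longleftrightarrow> \<not> universal n (bounded_degree_graphs n 2) {e \<in> A. f e \<or> g e}" for f g
  let ?\<delta> = "real n ^ 4 * exp (- (q\<^sup>2 * (real m / 3)))"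
  have finA: "finite A" by (simp add: A_def finite_imp_finite_nsets)
  have "measure_pmf.prob D {g. bad f g} \<le> 7 * ?\<delta>" if f: "ok f" for f
  proof -
    obtain hs where hs: "distinct hs" "set hs \<subseteq> ?V" "path_edges hs \<subseteq> {e \<in> A. f e}" "length hs = n - m"
    proof (rule long_path[of ?V ?k "{e \<in> A. f e}" "n - m"])
      fix D U assume *: "D \<subseteq> ?V" "U \<subseteq> ?V" "D \<inter> U = {}" "card D = ?k" "card U = ?k"
      then obtain d u where du: "d \<in> D" "u \<in> U" "f {d, u}" using f unfolding ok_def by blast
      then have "{d, u} \<in> A" using * by (auto simp: A_def nsets_def card_insert_if)
      then show "\<exists>d\<in>D. \<exists>u\<in>U. {d, u} \<in> {e \<in> A. f e}" using du by blast
    qed (use m in auto)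
    let ?Y = "?V - set hs"
    have Y: "card ?Y = m" using hs m by (simp add: card_Diff_subset distinct_card)
    have fT: "finite (templates m hs)" "card (templates m hs) \<le> 7"
    proof -
      \<comment> \<open>One template for long cycles and one for each of the six interval
        lengths.\<close>
      have "card (insert a (h ` {2..7::nat})) \<le> 7" for a and h :: "nat \<Rightarrow> (nat \<times> nat) set"
        using card_image_le[of "{2..7}" h] by (simp add: card_insert_if)
      then show "card (templates m hs) \<le> 7" unfolding templates_def by blast
      show "finite (templates m hs)" unfolding templates_def by simp
    qed
    \<comment> \<open>Outside \<open>A\<close> the default value \<open>False\<close> is guaranteed
      only on the support, so the bad event is restricted to it below.\<close>
    have mem: "e \<in> A" if "g \<in> set_pmf D" "g e" for g e
      using subsetD[OF set_Pi_pmf_subset[OF finA] that(1)[unfolded D_def]] that(2) by auto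
    have "{g. bad f g} \<inter> set_pmf D \<subseteq> (\<Union>M\<in>templates m hs. {g. \<not> cherry_matchable n ?Y M g})"
    proof (rule subsetI, rule ccontr)
      fix g assume g: "g \<in> {g. bad f g} \<inter> set_pmf D" "g \<notin> (\<Union>M\<in>templates m hs. {g. \<not> cherry_matchable n ?Y M g})"
      have "universal n (bounded_degree_graphs n 2) {e \<in> A. f e \<or> g e}"
        by (rule universal_of_long_path[of m n hs _ g]) (use m hs g mem in auto)
      then show False using g(1) by (simp add: bad_def)
    qed
    then have "measure_pmf.prob D ({g. bad f g} \<inter> set_pmf D) \<le>
        measure_pmf.prob D (\<Union>M\<in>templates m hs. {g. \<not> cherry_matchable n ?Y M g})"
      by (rule measure_pmf.finite_measure_mono) simp
    also have "\<dots> \<le> real (card (templates m hs)) * ?\<delta>"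
    proof (rule measure_pmf_UNION_le[OF fT(1)])
      fix M assume M: "M \<in> templates m hs"
      have "7 * m \<le> length hs" using hs(4) m by simp
      from templates_props[OF hs(1) this M] hs(2)
      have "M \<subseteq> ?V \<times> ?V" "card M = m" "matching M" by auto
      then show "measure_pmf.prob D {g. \<not> cherry_matchable n ?Y M g} \<le> ?\<delta>"
        unfolding D_def A_def by (rule prob_not_cherry_matchable[OF q]) (use Y m in auto)
    qed
    also have "\<dots> \<le> 7 * ?\<delta>" using fT(2) by (intro mult_right_mono) auto
    finally show ?thesis by (simp add: measure_Int_set_pmf)
  qed
  then have "measure_pmf.prob (pair_pmf D D) {(f, g). bad f g} \<le> measure_pmf.prob D {f. \<not> ok f} + 7 * ?\<delta>"
    by (rule prob_pair_pmf_le) auto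
  also have "measure_pmf.prob D {f. \<not> ok f} \<le> 4 ^ n * exp (- (q * real (?k * ?k)))"
    unfolding D_def A_def ok_def not_not by (rule prob_not_expanding[OF q])
  finally show ?thesis
    unfolding gnp_two_rounds[OF q] by (simp add: vimage_def bad_def D_def A_def case_prod_unfold)
qed

section \<open>Choice of constants and the limit\<close>

lemma prob_universal_ge:
  fixes p :: real
  assumes p: "0 \<le> p" "p \<le> 1" and n: "400 \<le> n" and pn: "100 * (ln (real n) / real n) powr (1 / 2) \<le> p"
  shows "1 - (4 ^ n * exp (- (real n * ln (real n) / 36)) + 7 * (real n ^ 4 * exp (- (6 * ln (real n)))))
    \<le> measure_pmf.prob (gnp n p) {G. universal n (bounded_degree_graphs n 2) G}"
proof -
  define q where "q = 1 - sqrt (1 - p)"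
  define m where "m = n div 60"
  have q: "0 \<le> q" "q \<le> 1" using p by (auto simp: q_def real_sqrt_le_1_iff)
  have pq: "p = 1 - (1 - q)\<^sup>2" using p by (simp add: q_def)
  \<comment> \<open>Hence \<open>q\<close> is at least half of \<open>p\<close>: splitting into two
    rounds costs only a constant factor.\<close>
  have "p = q * (2 - q)" using pq by (simp add: power2_eq_square algebra_simps)
  also have "\<dots> \<le> q * 2" using q by (intro mult_left_mono) auto
  finally have "p / 2 \<le> q" by simp
  then have q2: "p\<^sup>2 / 4 \<le> q\<^sup>2" using power_mono[of "p / 2" q 2] p by (simp add: power_divide)
  have ln: "0 \<le> ln (real n) / real n" "0 \<le> ln (real n)" using n by simp_all
  have "(100 * (ln (real n) / real n) powr (1 / 2))\<^sup>2 \<le> p\<^sup>2" using pn by (intro power_mono) auto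
  then have "10000 * (ln (real n) / real n) \<le> p\<^sup>2"
    using ln by (simp add: power_mult_distrib powr_half_sqrt)
  then have ql: "2500 * (ln (real n) / real n) \<le> q\<^sup>2" using q2 by linarith
  have m: "3 \<le> m" "60 * m \<le> n" "real n / 120 \<le> real m" using n by (auto simp: m_def)
  have k: "real n / 300 \<le> real (m div 2)" using n by (simp add: m_def)
  \<comment> \<open>The factor \<open>2500 / 360\<close> exceeds 6, and \<open>n ^ 6\<close> in the
    denominator beats the \<open>n ^ 4\<close> of the union bound.\<close>
  have "6 * ln (real n) \<le> 2500 * (ln (real n) / real n) * (real n / 120 / 3)" using ln n by simp
  also have "\<dots> \<le> q\<^sup>2 * (real m / 3)" using ql m ln by (intro mult_mono) auto
  finally have e1: "exp (- (q\<^sup>2 * (real m / 3))) \<le> exp (- (6 * ln (real n)))" by simp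
  have "real n * ln (real n) / 36 = 2500 * (ln (real n) / real n) * (real n / 300 * (real n / 300))"
    using n by (simp add: field_simps)
  also have "\<dots> \<le> q\<^sup>2 * (real (m div 2) * real (m div 2))" using ql k ln by (intro mult_mono) auto
  \<comment> \<open>Passing from \<open>q\<close> to its square is wasteful, but the exponent is
    still of order \<open>n ln n\<close>, which beats \<open>4 ^ n\<close>.\<close>
  also have "\<dots> \<le> q * (real (m div 2) * real (m div 2))"
    using q by (intro mult_right_mono) (auto simp: power2_eq_square mult_left_le)
  finally have e2: "exp (- (q * real (m div 2 * (m div 2)))) \<le> exp (- (real n * ln (real n) / 36))" by simp
  have "measure_pmf.prob (gnp n p) {G. \<not> universal n (bounded_degree_graphs n 2) G}
    \<le> 4 ^ n * exp (- (q * real (m div 2 * (m div 2)))) + 7 * (real n ^ 4 * exp (- (q\<^sup>2 * (real m / 3))))"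
    unfolding pq by (rule prob_not_universal[OF q m(1,2)])
  also have "\<dots> \<le> 4 ^ n * exp (- (real n * ln (real n) / 36)) + 7 * (real n ^ 4 * exp (- (6 * ln (real n))))"
    using e1 e2 by (intro add_mono mult_left_mono) auto
  finally show ?thesis
    using measure_pmf.prob_compl[of "{G. universal n (bounded_degree_graphs n 2) G}" "gnp n p"]
    by (simp add: Compl_eq_Diff_UNIV[symmetric] Collect_neg_eq)
qed

theorem theorem1p3:
  "\<exists>C::real. C > 0 \<and>
     (\<forall>p :: nat \<Rightarrow> real.
        (\<forall>n. 0 \<le> p n \<and> p n \<le> 1) \<longrightarrow>
        (\<forall>\<^sub>F n in sequentially. p n \<ge> C * (ln (real n) / real n) powr (1 / 2)) \<longrightarrow>
        (\<lambda>n. measure_pmf.prob (gnp n (p n)) {G. universal n (bounded_degree_graphs n 2) G})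
          \<longlonglongrightarrow> 1)"
proof (intro exI[of _ 100] conjI allI impI)
  fix p :: "nat \<Rightarrow> real"
  assume p: "\<forall>n. 0 \<le> p n \<and> p n \<le> 1"
    and ev: "\<forall>\<^sub>F n in sequentially. p n \<ge> 100 * (ln (real n) / real n) powr (1 / 2)"
  show "(\<lambda>n. measure_pmf.prob (gnp n (p n)) {G. universal n (bounded_degree_graphs n 2) G}) \<longlonglongrightarrow> 1"
  proof (rule tendsto_sandwich[where h = "\<lambda>_. 1"])
    show "\<forall>\<^sub>F n in sequentially.
      1 - (4 ^ n * exp (- (real n * ln (real n) / 36)) + 7 * (real n ^ 4 * exp (- (6 * ln (real n)))))
      \<le> measure_pmf.prob (gnp n (p n)) {G. universal n (bounded_degree_graphs n 2) G}"
      using ev eventually_ge_at_top[of 400] by eventually_elim (use p in \<open>auto intro: prob_universal_ge\<close>)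
    \<comment> \<open>The first error term is the exponential of
      \<open>n * ln 4 - n * ln n / 36\<close>, the second is \<open>7 / n ^ 2\<close>; both
      vanish.\<close>
    show "(\<lambda>n. 1 - (4 ^ n * exp (- (real n * ln (real n) / 36)) + 7 * (real n ^ 4 * exp (- (6 * ln (real n)))))) \<longlonglongrightarrow> (1::real)"
      by real_asymp
  qed (auto intro: always_eventually)
qed simp

end
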